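(* Let $d \geq 5$ and $\lceil \frac{d+1}{2} \rceil \leq k \leq d-2$. Let $X$ and $Y$ be normal, simplicial $(d-1)$-pseudomanifolds in which the link of each $(2k-d-1)$-face is a homology $(2d-2k-1)$-manifold. Then any poset isomorphism $\varphi:\mathscr{F}_{k-1}^k(X) \to \mathscr{F}_{k-1}^k(Y)$ extends to a poset isomorphism $\mathscr{F}(X) \to \mathscr{F}(Y)$.
   Context: All simplicial complexes are finite. For a simplicial complex $X$, $\mathscr{F}(X)$ is the poset of all faces of $X$ (including the empty face) ordered by containment, $\mathscr{F}^k(X)$ is the set of $k$-dimensional faces, and for $a \le b$, $\mathscr{F}_a^b(X) := \bigcup_{k=a}^b \mathscr{F}^k(X)$ with the induced partial order. Faces are identified with their vertex sets. For a face $G$ of $X$, the link $\operatorname{Lk}(G,X)$ is the subcomplex with faces $\{A \setminus G : A \in \mathscr{F}(X), G \subseteq A\}$. A simplicial $(m-1)$-pseudomanifold is an $(m-1)$-dimensional simplicial complex that is pure (every face is contained in an $(m-1)$-face) and in which every $(m-2)$-face is contained in exactly two $(m-1)$-faces. A simplicial $(m-1)$-pseudomanifold $X$ is normal if it is connected and $\operatorname{Lk}(G,X)$ is connected for every $j$-face $G$ with $0 \le j \le m-3$. A homology $(m-1)$-manifold is a connected simplicial $(m-1)$-pseudomanifold $X$ such that for each $0 \le j \le m-2$ and each $j$-face $G$ of $X$, the link $\operatorname{Lk}(G,X)$ has the $\mathbb{Z}_2$-homology of an $(m-j-2)$-sphere; that is, when $m-j-2\ge 1$, $H_i(\operatorname{Lk}(G,X),\mathbb{Z}_2)$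 is $\mathbb{Z}_2$ for $i=0$ and $i=m-j-2$, and is $0$ for $1 \le i \le m-j-3$. (When $j=m-2$, the link is two points, i.e. a 0-sphere, by the pseudomanifold condition.) *)

theory Defs
  imports Complex_Main "HOL-Algebra.Elementary_Groups"
begin

text \<open>
  Dimensions and homological degrees are integers, so that the empty face has dimension \<open>-1\<close>
  and no subtraction is truncated.
\<close>

definition simplicial_complex :: "'a set set \<Rightarrow> bool" where
  "simplicial_complex X \<longleftrightarrow>
     finite X \<and> {} \<in> X \<and> (\<forall>F\<in>X. finite F) \<and> (\<forall>F\<in>X. \<forall>G. G \<subseteq> F \<longrightarrow> G \<in> X)"

definition face_dim :: "'a set \<Rightarrow> int" where
  "face_dim F = int (card F) - 1"

definition faces :: "int \<Rightarrow> 'a set set \<Rightarrow> 'a set set" where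
  "faces k X = {F \<in> X. face_dim F = k}"

definition faces_between :: "int \<Rightarrow> int \<Rightarrow> 'a set set \<Rightarrow> 'a set set" where
  "faces_between a b X = (\<Union>k\<in>{a..b}. faces k X)"

definition complex_dim :: "'a set set \<Rightarrow> int" where
  "complex_dim X = Max (face_dim ` X)"

definition link :: "'a set \<Rightarrow> 'a set set \<Rightarrow> 'a set set" where
  "link G X = {A - G | A. A \<in> X \<and> G \<subseteq> A}"

text \<open>Connectedness of the complex is connectedness of its 1-skeleton.\<close>

definition connected_complex :: "'a set set \<Rightarrow> bool" where
  "connected_complex X \<longleftrightarrow> (\<forall>u\<in>\<Union>X. \<forall>v\<in>\<Union>X. (u, v) \<in> {(x, y). {x, y} \<in> X}\<^sup>*)"

definition pseudomanifold :: "int \<Rightarrow> 'a set set \<Rightarrow> bool" where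
  "pseudomanifold n X \<longleftrightarrow>
     simplicial_complex X \<and> complex_dim X = n \<and>
     (\<forall>F\<in>X. \<exists>G\<in>faces n X. F \<subseteq> G) \<and>
     (\<forall>F\<in>faces (n - 1) X. card {G \<in> faces n X. F \<subseteq> G} = 2)"

definition normal_pseudomanifold :: "int \<Rightarrow> 'a set set \<Rightarrow> bool" where
  "normal_pseudomanifold n X \<longleftrightarrow>
     pseudomanifold n X \<and> connected_complex X \<and>
     (\<forall>j G. 0 \<le> j \<and> j \<le> n - 2 \<and> G \<in> faces j X \<longrightarrow> connected_complex (link G X))"

text \<open>
  Simplicial homology with coefficients in the field of two elements.  A chain is identified with
  its support, a set of nonempty faces; addition of chains is then symmetric difference.  The empty
  face is excluded from the chains, so the homology is unreduced.
\<close>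

definition chain_group :: "'a set set \<Rightarrow> int \<Rightarrow> 'a set set monoid" where
  "chain_group X i =
     \<lparr>carrier = Pow (faces i X - {{}}), monoid.mult = (\<lambda>c e. sym_diff c e), one = {}\<rparr>"

definition boundary :: "'a set set \<Rightarrow> int \<Rightarrow> 'a set set \<Rightarrow> 'a set set" where
  "boundary X i c = {F \<in> faces (i - 1) X - {{}}. odd (card {G \<in> c. F \<subseteq> G})}"

definition cycles :: "'a set set \<Rightarrow> int \<Rightarrow> 'a set set set" where
  "cycles X i = kernel (chain_group X i) (chain_group X (i - 1)) (boundary X i)"

definition boundaries :: "'a set set \<Rightarrow> int \<Rightarrow> 'a set set set" where
  "boundaries X i = boundary X (i + 1) ` carrier (chain_group X (i + 1))"

definition homology_Z2 :: "int \<Rightarrow> 'a set set \<Rightarrow> 'a set set set monoid" where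
  "homology_Z2 i X = (chain_group X i)\<lparr>carrier := cycles X i\<rparr> Mod boundaries X i"

text \<open>
  Used only for \<open>n \<ge> 1\<close> and complexes of dimension \<open>n\<close>, whose homology above
  degree \<open>n\<close> vanishes automatically.
\<close>

definition has_Z2_homology_of_sphere :: "int \<Rightarrow> 'a set set \<Rightarrow> bool" where
  "has_Z2_homology_of_sphere n L \<longleftrightarrow>
     homology_Z2 0 L \<cong> integer_mod_group 2 \<and>
     homology_Z2 n L \<cong> integer_mod_group 2 \<and>
     (\<forall>i. 1 \<le> i \<and> i \<le> n - 1 \<longrightarrow> trivial_group (homology_Z2 i L))"

text \<open>
  The link of a \<open>j\<close>-face has dimension \<open>n - j - 1\<close>.  For \<open>j = n - 1\<close> no homological
  condition is imposed: by the pseudomanifold condition such a link consists of two points.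
\<close>

definition homology_manifold :: "int \<Rightarrow> 'a set set \<Rightarrow> bool" where
  "homology_manifold n X \<longleftrightarrow>
     pseudomanifold n X \<and> connected_complex X \<and>
     (\<forall>j G. 0 \<le> j \<and> j \<le> n - 1 \<and> G \<in> faces j X \<and> n - j - 1 \<ge> 1 \<longrightarrow>
        has_Z2_homology_of_sphere (n - j - 1) (link G X))"

definition poset_iso :: "'p::order set \<Rightarrow> 'q::order set \<Rightarrow> ('p \<Rightarrow> 'q) \<Rightarrow> bool" where
  "poset_iso P Q f \<longleftrightarrow> bij_betw f P Q \<and> (\<forall>x\<in>P. \<forall>y\<in>P. x \<le> y \<longleftrightarrow> f x \<le> f y)"

end

theory Submission
  imports Defs
begin

text \<open>
  The proof has two independent halves: the two levels of faces determine the skeleton of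
  dimension \<open>k\<close>, and that skeleton determines the complex.

  \<^bold>\<open>Levels determine the skeleton.\<close>  Counted by vertices, the given levels consist of the faces
  with \<open>k\<close> and with \<open>k + 1\<close> vertices.  If three faces of size \<open>j\<close> lie pairwise in common faces of
  size \<open>j + 1\<close> and these are not all the same, then the three pairwise intersections coincide
  (\<open>triangle_common_intersection\<close>).  The configuration is expressed by incidences alone, so an
  isomorphism preserves it.  Every edge of the link of a face \<open>A\<close> yields, for each facet
  of \<open>A\<close>, such a configuration through \<open>A\<close>; as links are connected, the isomorphism therefore
  preserves all statements ``\<open>B\<close> and \<open>C\<close> meet \<open>A\<close> in the same face of size \<open>j - 1\<close>''.
  Connectedness of the links of the smaller faces then gives every face of size \<open>j - 1\<close> a well defined image, and the isomorphism descends one level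
  (\<open>incidence_iso_descend\<close>).  At the bottom it is a bijection of vertices which induces all the
  maps above it (\<open>vertex_map_exists\<close>).

  \<^bold>\<open>The skeleton determines the complex.\<close>  Put \<open>m = d - k\<close>.  The link of a face with
  \<open>2k - d + 1\<close> vertices is a vertex link in a homology manifold of dimension \<open>2m - 1\<close>, so it is a
  homology sphere \<open>S\<close> of dimension \<open>2m - 2\<close> all of whose links are homology spheres; and of \<open>S\<close> the
  faces with at most \<open>m\<close> vertices are known.  They determine \<open>S\<close> by a case of Alexander duality.
  Let \<open>\<sigma>\<close> be a set of more than \<open>m\<close> vertices whose proper subsets are faces, and let \<open>K\<close> consist of the
  faces disjoint from \<open>\<sigma>\<close>.  If \<open>\<sigma>\<close> is a face, \<open>K\<close> is acyclic (\<open>acyclic_avoiding_face\<close>).  If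
  \<open>\<sigma>\<close> is not a face, the link of a facet of \<open>\<sigma>\<close> is a cycle in \<open>K\<close> that links the boundary of \<open>\<sigma>\<close>
  once and does not bound (\<open>missing_face_links_nontrivially\<close>).  This cycle and any
  homogeneous chain bounding it consist of faces with at most \<open>m\<close> vertices, so the known part of \<open>S\<close> tells the two
  cases apart (\<open>homology_sphere_determined_by_half_skeleton\<close>).

  Both homological facts are inductions over vertex links, with chains modulo two treated as plain
  sets of faces.  The homology is reduced (the empty face is a chain) and ungraded (a chain may mix
  dimensions).  Cones and links of chains are then unrestricted operations, and only the final
  comparison of skeleta has to look at dimensions.
\<close>

section \<open>Chains modulo two\<close>

definition cofacets :: "'a set \<Rightarrow> 'a set set \<Rightarrow> 'a set" where
  "cofacets F c = {v. v \<notin> F \<and> insert v F \<in> c}"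

text \<open>
  The boundary modulo two, on arbitrary sets of sets: it does not refer to an ambient complex or to a
  dimension.  The empty set is the boundary of a single vertex, which makes the homology reduced.
\<close>

definition bd :: "'a set set \<Rightarrow> 'a set set" where
  "bd c = {F. odd (card (cofacets F c))}"

text \<open>
  Both the vertex link of a complex and the part of a chain that passes through a vertex.
\<close>

definition lk :: "'a \<Rightarrow> 'a set set \<Rightarrow> 'a set set" where
  "lk v c = {F. v \<notin> F \<and> insert v F \<in> c}"

definition cone :: "'a \<Rightarrow> 'a set set \<Rightarrow> 'a set set" where
  "cone v g = insert v ` g"

lemma finite_cofacets:
  assumes "finite c"
  shows "finite (cofacets F c)"
proof -
  have "inj_on (\<lambda>v. insert v F) (cofacets F c)"
    by (auto simp: inj_on_def cofacets_def)
  moreover have "(\<lambda>v. insert v F) ` cofacets F c \<subseteq> c"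
    by (auto simp: cofacets_def)
  ultimately show ?thesis
    using assms finite_subset finite_imageD by metis
qed

lemma odd_card_sym_diff:
  assumes "finite A" "finite B"
  shows "odd (card (sym_diff A B)) \<longleftrightarrow> odd (card A) \<noteq> odd (card B)"
proof -
  have "card A = card (A - B) + card (A \<inter> B)" "card B = card (B - A) + card (A \<inter> B)"
    using assms by (metis card_Diff_subset_Int card_Int_Diff add.commute finite_Int inf_commute)+
  moreover have "card (sym_diff A B) = card (A - B) + card (B - A)"
    using assms by (intro card_Un_disjoint) auto
  ultimately show ?thesis by auto
qed

lemma bd_sym_diff:
  assumes "finite c" "finite c'"
  shows "bd (sym_diff c c') = sym_diff (bd c) (bd c')"
proof -
  have "cofacets F (sym_diff c c') = sym_diff (cofacets F c) (cofacets F c')" for F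
    by (auto simp: cofacets_def)
  then show ?thesis
    using odd_card_sym_diff[OF finite_cofacets[OF assms(1)] finite_cofacets[OF assms(2)]]
    by (auto simp: bd_def)
qed

lemma bd_empty [simp]: "bd {} = {}"
  by (simp add: bd_def cofacets_def)

lemma bdE:
  assumes "F \<in> bd c"
  obtains v where "v \<notin> F" "insert v F \<in> c"
proof -
  have "cofacets F c \<noteq> {}" using assms by (auto simp: bd_def)
  then show ?thesis using that by (auto simp: cofacets_def)
qed

lemma even_card_symmetric_irreflexive:
  assumes "finite P" "\<And>a b. (a, b) \<in> P \<Longrightarrow> (b, a) \<in> P" "\<And>a. (a, a) \<notin> P"
  shows "even (card P)"
  using assms
proof (induction "card P" arbitrary: P rule: less_induct)
  case less
  show ?case
  proof (cases "P = {}")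
    case False
    then obtain a b where ab: "(a, b) \<in> P" by fast
    then have ba: "(b, a) \<in> P" "a \<noteq> b" using less.prems by auto
    let ?Q = "P - {(a, b), (b, a)}"
    have c: "card P = card ?Q + 2"
      using ab ba less.prems(1) card_Diff_subset[of "{(a, b), (b, a)}" P] 
        card_mono[of P "{(a, b), (b, a)}"] by auto
    have "even (card ?Q)"
      by (rule less.hyps) (use c less.prems in auto)
    then show ?thesis using c by simp
  qed simp
qed

lemma odd_card_Sigma:
  assumes "finite A" "\<And>a. finite (B a)"
  shows "odd (card (Sigma A B)) \<longleftrightarrow> odd (card {a \<in> A. odd (card (B a))})"
proof -
  have "card (Sigma A B) = (\<Sum>a\<in>A. card (B a))"
    using assms by simp
  also have "odd \<dots> \<longleftrightarrow> odd (card {a \<in> A. odd (card (B a))})"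
    using assms(1) by (metis even_sum_iff)
  finally show ?thesis .
qed

text \<open>
  A set \<open>F\<close> would be counted once for every ordered pair \<open>(v, w)\<close> with \<open>F \<union> {v, w}\<close> in the chain, and
  exchanging \<open>v\<close> and \<open>w\<close> pairs these off.
\<close>

lemma bd_bd:
  assumes "finite c"
  shows "bd (bd c) = {}"
proof -
  have "even (card (cofacets F (bd c)))" for F
  proof -
    define W where "W = {v. v \<notin> F \<and> (\<exists>w. w \<notin> insert v F \<and> insert w (insert v F) \<in> c)}"
    \<comment> \<open>the members of \<open>c\<close> need not be finite sets, but those that matter exceed \<open>F\<close> by two elements\<close>
    have "W \<subseteq> \<Union> ((\<lambda>A. A - F) ` {A \<in> c. card (A - F) = 2})"
    proof
      fix v assume "v \<in> W"
      then obtain w where w: "v \<notin> F" "w \<notin> insert v F" "insert w (insert v F) \<in> c"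
        by (auto simp: W_def)
      then have "insert w (insert v F) - F = {v, w}" by auto
      then show "v \<in> \<Union> ((\<lambda>A. A - F) ` {A \<in> c. card (A - F) = 2})"
        using w by (intro UnionI[of "{v, w}"] image_eqI[of _ _ "insert w (insert v F)"]) auto
    qed
    moreover have "finite (\<Union> ((\<lambda>A. A - F) ` {A \<in> c. card (A - F) = 2}))"
      using assms by (intro finite_Union) (auto intro: card_ge_0_finite)
    ultimately have finW: "finite W" by (rule finite_subset)
    let ?B = "\<lambda>v. cofacets (insert v F) c"
    have "cofacets F (bd c) = {v \<in> W. odd (card (?B v))}"
      by (auto simp: W_def cofacets_def bd_def elim: odd_card_imp_not_empty)
        (metis (mono_tags, lifting) card.empty empty_Collect_eq even_zero insert_iff)+
    moreover have "even (card (Sigma W ?B))"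
    proof (rule even_card_symmetric_irreflexive)
      show "finite (Sigma W ?B)" using finW finite_cofacets[OF assms] by auto
      show "(w, v) \<in> Sigma W ?B" if "(v, w) \<in> Sigma W ?B" for v w
      proof -
        have *: "v \<notin> F" "w \<notin> F" "v \<noteq> w" "insert v (insert w F) \<in> c"
          using that by (auto simp: W_def cofacets_def insert_commute)
        then have "w \<in> W" unfolding W_def by auto
        then show ?thesis using * by (auto simp: cofacets_def)
      qed
    qed (auto simp: cofacets_def)
    ultimately show ?thesis
      using odd_card_Sigma[OF finW, of ?B] finite_cofacets[OF assms] by auto
  qed
  then show ?thesis by (auto simp: bd_def[of "bd c"])
qed

text \<open>
  Passing to the link of a vertex is a chain map.  All inductions over vertex links rest on this.
\<close>

lemma lk_bd: "lk v (bd c) = bd (lk v c)"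
proof -
  have "F \<in> lk v (bd c) \<longleftrightarrow> F \<in> bd (lk v c)" for F
  proof (cases "v \<in> F")
    case True
    then have "cofacets F (lk v c) = {}" by (auto simp: cofacets_def lk_def)
    then show ?thesis using True by (simp add: bd_def lk_def)
  next
    case False
    then have "cofacets (insert v F) c = cofacets F (lk v c)"
      by (auto simp: cofacets_def lk_def insert_commute)
    then show ?thesis using False by (simp add: bd_def lk_def)
  qed
  then show ?thesis by blast
qed

lemma lk_sym_diff: "lk v (sym_diff c c') = sym_diff (lk v c) (lk v c')"
  by (auto simp: lk_def)

lemma lk_empty_iff: "lk v c = {} \<longleftrightarrow> (\<forall>F\<in>c. v \<notin> F)"
  by (auto simp: lk_def) (metis insert_Diff Diff_iff insertI1)

lemma lk_cone:
  assumes "\<forall>F\<in>g. v \<notin> F"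
  shows "lk v (cone v g) = g"
  using assms by (auto simp: lk_def cone_def) (metis insert_ident)

lemma bd_cone_cycle:
  assumes "\<forall>F\<in>z. v \<notin> F" "bd z = {}"
  shows "bd (cone v z) = z"
proof -
  have "F \<in> bd (cone v z) \<longleftrightarrow> F \<in> z" for F
  proof (cases "v \<in> F")
    case True
    have "lk v (bd (cone v z)) = {}"
      using assms by (simp add: lk_bd lk_cone)
    then show ?thesis using True assms(1) by (auto simp: lk_empty_iff)
  next
    case False
    have "cofacets F (cone v z) = (if F \<in> z then {v} else {})"
    proof -
      have "w \<in> cofacets F (cone v z) \<longleftrightarrow> w = v \<and> F \<in> z" for w
        using False assms(1) by (auto simp: cofacets_def cone_def) (metis insert_ident insert_iff)+
      then show ?thesis by auto
    qed
    then show ?thesis by (auto simp: bd_def)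
  qed
  then show ?thesis by blast
qed

section \<open>Homology spheres and faces removed from them\<close>

definition acyclic_complex :: "'a set set \<Rightarrow> bool" where
  "acyclic_complex K \<longleftrightarrow> (\<forall>z. z \<subseteq> K \<and> bd z = {} \<longrightarrow> (\<exists>e\<subseteq>K. bd e = z))"

definition avoiding :: "'a set \<Rightarrow> 'a set set \<Rightarrow> 'a set set" where
  "avoiding \<sigma> S = {F \<in> S. F \<inter> \<sigma> = {}}"

abbreviation faces_of_size :: "nat \<Rightarrow> 'a set set \<Rightarrow> 'a set set" where
  "faces_of_size n S \<equiv> {F \<in> S. card F = n}"

text \<open>
  The index is the number of vertices of a facet, so it exceeds the dimension by one.  The
  clause on cycles says that the reduced homology is generated by the sum of all facets; that this sum is
  not itself a boundary follows from the bound on the size of faces.  The recursion asks the same of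
  all iterated vertex links, that is, of all links.
\<close>

fun homology_sphere :: "nat \<Rightarrow> 'a set set \<Rightarrow> bool" where
  "homology_sphere 0 S \<longleftrightarrow> S = {{}}"
| "homology_sphere (Suc n) S \<longleftrightarrow>
     simplicial_complex S \<and> (\<forall>F\<in>S. card F \<le> Suc n) \<and>
     faces_of_size (Suc n) S \<noteq> {} \<and> bd (faces_of_size (Suc n) S) = {} \<and>
     (\<forall>z\<subseteq>S. bd z = {} \<longrightarrow>
        (\<exists>e\<subseteq>S. z = bd e \<or> z = sym_diff (bd e) (faces_of_size (Suc n) S))) \<and>
     (\<forall>v. {v} \<in> S \<longrightarrow> homology_sphere n (lk v S))"

lemma acyclic_complexD:
  assumes "acyclic_complex K" "z \<subseteq> K" "bd z = {}"
  shows "\<exists>e\<subseteq>K. bd e = z"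
  using assms by (auto simp: acyclic_complex_def)

lemma simplicial_complexD:
  assumes "simplicial_complex X"
  shows "finite X" "{} \<in> X" "F \<in> X \<Longrightarrow> finite F" "F \<in> X \<Longrightarrow> G \<subseteq> F \<Longrightarrow> G \<in> X"
  using assms by (auto simp: simplicial_complex_def)

lemma lk_mono: "c \<subseteq> K \<Longrightarrow> lk v c \<subseteq> lk v K"
  by (auto simp: lk_def)

lemma lk_subset:
  assumes "simplicial_complex K"
  shows "lk v K \<subseteq> K"
  using simplicial_complexD(4)[OF assms] by (auto simp: lk_def)

lemma homology_sphere_complex:
  "homology_sphere n S \<Longrightarrow> simplicial_complex S"
  by (cases n) (auto simp: simplicial_complex_def)

lemma homology_sphere_card_le:
  "homology_sphere n S \<Longrightarrow> F \<in> S \<Longrightarrow> card F \<le> n"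
  by (cases n) auto

lemma top_faces_not_bd:
  assumes "homology_sphere n S" "e \<subseteq> S"
  shows "bd e \<noteq> faces_of_size n S"
proof
  assume e: "bd e = faces_of_size n S"
  obtain F where F: "F \<in> faces_of_size n S"
    using assms by (cases n) auto
  then obtain v where v: "v \<notin> F" "insert v F \<in> e" using e bdE by metis
  then have "card (insert v F) \<le> n" using assms homology_sphere_card_le by blast
  moreover have "finite F"
    using F simplicial_complexD(3)[OF homology_sphere_complex[OF assms(1)]] by auto
  ultimately show False using F v by simp
qed

lemma bd_top_faces:
  assumes "homology_sphere n S"
  shows "bd (faces_of_size n S) = {}"
proof (cases n)
  case 0
  then have "faces_of_size n S = {{}}" using assms by auto
  then show ?thesis by (auto elim!: bdE)
next
  case (Suc m)
  then show ?thesis using assms by simp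
qed

lemma lk_top_faces:
  assumes "simplicial_complex S"
  shows "lk v (faces_of_size (Suc n) S) = faces_of_size n (lk v S)"
proof -
  have "card (insert v F) = Suc n \<longleftrightarrow> card F = n" if "v \<notin> F" "insert v F \<in> S" for F
    using that simplicial_complexD(3)[OF assms that(2)] by simp
  then show ?thesis by (auto simp: lk_def)
qed

lemma homology_sphere_lk:
  assumes "homology_sphere n S" "{v} \<in> S"
  obtains n' where "n = Suc n'" "homology_sphere n' (lk v S)"
proof (cases n)
  case 0
  then show ?thesis using assms by simp
next
  case (Suc m)
  then show ?thesis using assms that[of m] by simp
qed

lemma homology_sphere_cycle:
  assumes "homology_sphere n S" "z \<subseteq> S" "bd z = {}"
  shows "\<exists>e\<subseteq>S. z = bd e \<or> z = sym_diff (bd e) (faces_of_size n S)"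
proof (cases n)
  case 0
  then have "z = {} \<or> z = {{}}" "faces_of_size n S = {{}}" using assms by auto
  then have "z = bd {} \<or> z = sym_diff (bd {}) (faces_of_size n S)" by auto
  then show ?thesis by blast
next
  case (Suc m)
  with assms show ?thesis by (simp del: Un_iff)
qed

lemma bd_subset_complex:
  assumes "simplicial_complex K" "e \<subseteq> K"
  shows "bd e \<subseteq> K"
proof
  fix F assume "F \<in> bd e"
  then obtain v where "v \<notin> F" "insert v F \<in> e" by (rule bdE)
  then show "F \<in> K" using assms simplicial_complexD(4)[OF assms(1), of "insert v F" F] by blast
qed

text \<open>
  If the part of a chain at \<open>v\<close> bounds inside the link of \<open>v\<close>, then adding the boundary of a cone over the
  bounding chain moves the given chain off \<open>v\<close> and keeps its boundary.
\<close>

lemma push_off_vertex: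
  assumes "simplicial_complex K" "e \<subseteq> K" "g \<subseteq> lk v K" "bd g = lk v e"
  obtains e' where "e' \<subseteq> {F \<in> K. v \<notin> F}" "bd e' = bd e"
proof -
  have fin: "finite K" using assms simplicial_complexD by blast
  have g: "\<forall>F\<in>g. v \<notin> F" "cone v g \<subseteq> K" using assms(3) by (auto simp: lk_def cone_def)
  let ?h = "bd (cone v g)"
  have fe: "finite e" "finite (cone v g)" using fin assms(2) g finite_subset by blast+
  have hK: "?h \<subseteq> K"
    using g(2) simplicial_complexD(4)[OF assms(1)] by (auto elim!: bdE)
  have fh: "finite ?h" using hK fin finite_subset by blast
  have "lk v (sym_diff e ?h) = sym_diff (lk v e) (bd (lk v (cone v g)))"
    by (simp only: lk_sym_diff lk_bd)
  also have "\<dots> = {}" using assms(4) lk_cone[OF g(1)] by simp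
  finally have "\<forall>F\<in>sym_diff e ?h. v \<notin> F" by (simp only: lk_empty_iff)
  moreover have "bd (sym_diff e ?h) = bd e"
    using bd_sym_diff[OF fe(1) fh] bd_bd[OF fe(2)] by simp
  moreover have "sym_diff e ?h \<subseteq> K" using hK assms(2) by blast
  ultimately show ?thesis using that[of "sym_diff e ?h"] by blast
qed

text \<open>
  The part of Mayer--Vietoris that is needed: removing the star of \<open>v\<close> from an acyclic complex keeps it
  acyclic if the link of \<open>v\<close> is acyclic.
\<close>

lemma acyclic_delete_vertex:
  assumes "simplicial_complex K" "acyclic_complex K" "acyclic_complex (lk v K)"
  shows "acyclic_complex {F \<in> K. v \<notin> F}"
  unfolding acyclic_complex_def
proof (intro allI impI; elim conjE)
  fix z assume z: "z \<subseteq> {F \<in> K. v \<notin> F}" "bd z = {}"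
  then have "z \<subseteq> K" by blast
  then obtain e where e: "e \<subseteq> K" "bd e = z"
    using acyclic_complexD[OF assms(2) _ z(2)] by blast
  have "bd (lk v e) = lk v z" using e lk_bd by metis
  also have "lk v z = {}" using z by (auto simp: lk_empty_iff)
  finally obtain g where "g \<subseteq> lk v K" "bd g = lk v e"
    using acyclic_complexD[OF assms(3) lk_mono[OF e(1)]] by blast
  then show "\<exists>e\<subseteq>{F \<in> K. v \<notin> F}. bd e = z"
    using push_off_vertex[OF assms(1) e(1)] e(2) by metis
qed

text \<open>
  A sphere minus an open ball is a ball.  Compared with deletion from an acyclic complex there are two
  obstructions, the top classes of the sphere and of the link of \<open>v\<close>.  The former does not occur in
  a cycle that avoids \<open>v\<close>, as the top class of the link would then bound.  If the latter obstructs
  pushing a chain off \<open>v\<close>, adding the sum of all facets of the sphere to the chain removes it.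
\<close>

lemma acyclic_sphere_delete_vertex:
  assumes S: "homology_sphere n S" and v: "{v} \<in> S"
  shows "acyclic_complex {F \<in> S. v \<notin> F}"
  unfolding acyclic_complex_def
proof (intro allI impI; elim conjE)
  fix z assume z: "z \<subseteq> {F \<in> S. v \<notin> F}" "bd z = {}"
  note cpx = homology_sphere_complex[OF S]
  obtain n' where n': "n = Suc n'" and L: "homology_sphere n' (lk v S)"
    using homology_sphere_lk[OF S v] .
  let ?Z = "faces_of_size n S" and ?ZL = "faces_of_size n' (lk v S)"
  have lkZ: "lk v ?Z = ?ZL" using lk_top_faces[OF cpx] n' by simp
  have lkz: "lk v z = {}" using z by (auto simp: lk_empty_iff)
  obtain e where e: "e \<subseteq> S" and ez: "z = bd e \<or> z = sym_diff (bd e) ?Z"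
    using homology_sphere_cycle[OF S _ z(2)] z(1) by blast
  have "z \<noteq> sym_diff (bd e) ?Z"
  proof
    assume "z = sym_diff (bd e) ?Z"
    then have "{} = sym_diff (bd (lk v e)) ?ZL"
      using lkz lk_sym_diff[of v "bd e" ?Z] lkZ lk_bd by metis
    then have "bd (lk v e) = ?ZL" by blast
    then show False using top_faces_not_bd[OF L lk_mono[OF e]] by blast
  qed
  then have ez: "z = bd e" using ez by blast
  have "bd (lk v e) = {}" using ez lkz lk_bd by metis
  then obtain g where g: "g \<subseteq> lk v S" "lk v e = bd g \<or> lk v e = sym_diff (bd g) ?ZL"
    using homology_sphere_cycle[OF L lk_mono[OF e]] by blast
  have fin: "finite e" "finite ?Z" using simplicial_complexD(1)[OF cpx] e finite_subset by auto
  from g(2) obtain e' where e': "e' \<subseteq> S" "lk v e' = bd g" "bd e' = z"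
  proof
    assume "lk v e = bd g"
    then show ?thesis using that e ez by blast
  next
    assume *: "lk v e = sym_diff (bd g) ?ZL"
    have "lk v (sym_diff e ?Z) = sym_diff (sym_diff (bd g) ?ZL) ?ZL"
      using lk_sym_diff[of v e ?Z] * lkZ by simp
    then have "lk v (sym_diff e ?Z) = bd g" by blast
    moreover have "bd (sym_diff e ?Z) = z"
      using bd_sym_diff[OF fin] bd_top_faces[OF S] ez by simp
    moreover have "sym_diff e ?Z \<subseteq> S" using e by blast
    ultimately show ?thesis using that by blast
  qed
  then show "\<exists>e\<subseteq>{F \<in> S. v \<notin> F}. bd e = z"
    using push_off_vertex[OF cpx e'(1) g(1)] by metis
qed

lemma lk_avoiding:
  assumes "v \<notin> \<sigma>"
  shows "lk v (avoiding \<sigma> S) = avoiding \<sigma> (lk v S)"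
proof -
  have "insert v F \<inter> \<sigma> = F \<inter> \<sigma>" for F using assms by simp
  then show ?thesis unfolding lk_def avoiding_def mem_Collect_eq by blast
qed

lemma simplicial_complex_avoiding:
  assumes "simplicial_complex S"
  shows "simplicial_complex (avoiding \<sigma> S)"
proof -
  have "G \<in> avoiding \<sigma> S" if "F \<in> avoiding \<sigma> S" "G \<subseteq> F" for F G
    using that simplicial_complexD(4)[OF assms, of F G] by (auto simp: avoiding_def)
  moreover have "finite (avoiding \<sigma> S)" "{} \<in> avoiding \<sigma> S" "\<forall>F\<in>avoiding \<sigma> S. finite F"
    using simplicial_complexD(1-3)[OF assms] by (simp_all add: avoiding_def)
  ultimately show ?thesis unfolding simplicial_complex_def by blast
qed

text \<open>
  The complement of a ball in a sphere is acyclic.  The vertices of the face are deleted one at a time; the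
  link of the next vertex in what is left is the complement of the remaining face in a smaller sphere.
\<close>

lemma acyclic_avoiding_face:
  assumes "homology_sphere n S" "\<sigma> \<in> S" "\<sigma> \<noteq> {}"
  shows "acyclic_complex (avoiding \<sigma> S)"
proof -
  have "finite \<sigma>" using assms simplicial_complexD(3) homology_sphere_complex by blast
  from this assms(3,1,2) show ?thesis
  proof (induction \<sigma> arbitrary: n S rule: finite_ne_induct)
    case (singleton v)
    have "avoiding {v} S = {F \<in> S. v \<notin> F}" by (auto simp: avoiding_def)
    then show ?case using acyclic_sphere_delete_vertex[OF singleton.prems] by simp
  next
    case (insert v \<sigma>)
    note cpx = homology_sphere_complex[OF insert.prems(1)]
    have in_S: "\<sigma> \<in> S" "{v} \<in> S"
      using simplicial_complexD(4)[OF cpx insert.prems(2)] by auto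
    obtain n' where L: "homology_sphere n' (lk v S)"
      using homology_sphere_lk[OF insert.prems(1) in_S(2)] .
    have "\<sigma> \<in> lk v S" using insert.hyps insert.prems by (simp add: lk_def)
    then have "acyclic_complex (lk v (avoiding \<sigma> S))"
      using insert.IH[OF L] lk_avoiding[OF insert.hyps(3)] by simp
    then have "acyclic_complex {F \<in> avoiding \<sigma> S. v \<notin> F}"
      using acyclic_delete_vertex[OF simplicial_complex_avoiding[OF cpx]] 
        insert.IH[OF insert.prems(1) in_S(1)] by blast
    moreover have "{F \<in> avoiding \<sigma> S. v \<notin> F} = avoiding (insert v \<sigma>) S"
      by (auto simp: avoiding_def)
    ultimately show ?case by simp
  qed
qed

section \<open>Linking with the boundary of a missing face\<close>

text \<open>
  The sum of the facets of the link of \<open>\<tau>\<close>, which is the fundamental cycle of that link.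
\<close>

definition link_top_faces :: "nat \<Rightarrow> 'a set \<Rightarrow> 'a set set \<Rightarrow> 'a set set" where
  "link_top_faces n \<tau> S = {F. F \<inter> \<tau> = {} \<and> F \<union> \<tau> \<in> S \<and> card F + card \<tau> = n}"

lemma link_top_faces_insert:
  assumes "finite \<tau>" "v \<notin> \<tau>"
  shows "link_top_faces (Suc n) (insert v \<tau>) S = link_top_faces n \<tau> (lk v S)"
proof -
  have "F \<in> link_top_faces (Suc n) (insert v \<tau>) S \<longleftrightarrow> F \<in> link_top_faces n \<tau> (lk v S)" for F
  proof -
    have "F \<inter> insert v \<tau> = {} \<longleftrightarrow> v \<notin> F \<union> \<tau> \<and> F \<inter> \<tau> = {}" using assms(2) by auto
    moreover have "F \<union> insert v \<tau> = insert v (F \<union> \<tau>)" by simp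
    moreover have "card F + card (insert v \<tau>) = Suc n \<longleftrightarrow> card F + card \<tau> = n"
      using assms by simp
    ultimately show ?thesis by (simp only: link_top_faces_def lk_def mem_Collect_eq) argo
  qed
  then show ?thesis by blast
qed

text \<open>
  The facets of the link of \<open>\<tau>\<close> arise from the facets of the sphere by passing to vertex links
  one vertex at a time, and the links are homology spheres.
\<close>

lemma bd_link_top_faces:
  assumes "finite \<tau>" "homology_sphere n S" "\<tau> \<in> S"
  shows "bd (link_top_faces n \<tau> S) = {}"
  using assms
proof (induction \<tau> arbitrary: n S rule: finite_induct)
  case empty
  then show ?case using bd_top_faces[OF empty.prems(1)] by (simp add: link_top_faces_def)
next
  case (insert v \<tau>)
  have "{v} \<in> S"
    using simplicial_complexD(4)[OF homology_sphere_complex insert.prems(2)] insert.prems(1) by blast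
  then obtain n' where n': "n = Suc n'" and L: "homology_sphere n' (lk v S)"
    using homology_sphere_lk[OF insert.prems(1)] by blast
  have "\<tau> \<in> lk v S" using insert by (simp add: lk_def)
  then show ?case using insert.IH[OF L] link_top_faces_insert[OF insert.hyps] n' by simp
qed

lemma link_top_faces_avoiding:
  assumes "simplicial_complex S" "insert x \<tau> \<notin> S"
  shows "link_top_faces n \<tau> S \<subseteq> avoiding (insert x \<tau>) S"
proof
  fix F assume F: "F \<in> link_top_faces n \<tau> S"
  then have FS: "F \<union> \<tau> \<in> S" "F \<inter> \<tau> = {}" by (auto simp: link_top_faces_def)
  have "x \<notin> F"
  proof
    assume "x \<in> F"
    then have "insert x \<tau> \<subseteq> F \<union> \<tau>" by auto
    then show False using FS assms simplicial_complexD(4)[OF assms(1)] by blast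
  qed
  then show "F \<in> avoiding (insert x \<tau>) S"
    using FS simplicial_complexD(4)[OF assms(1), of "F \<union> \<tau>" F] by (auto simp: avoiding_def)
qed

text \<open>
  Induction on \<open>\<tau>\<close>, replacing the sphere by the link of a vertex \<open>v\<close> of \<open>\<tau>\<close>.  If the cycle \<open>z\<close> were the
  boundary of \<open>c\<close>, then \<open>c\<close> and the cone over \<open>z\<close> with apex \<open>v\<close> would form a cycle that avoids the face
  \<open>insert x \<tau>\<close> with \<open>v\<close> removed.  By acyclicity that cycle bounds, and the part at \<open>v\<close> of the bounding chain
  bounds \<open>z\<close> inside the link of \<open>v\<close>.  When \<open>\<tau>\<close> is empty, \<open>z\<close> is the sum of all facets, which bounds nothing.
\<close>

lemma missing_face_links_nontrivially:
  assumes "finite \<tau>" "homology_sphere n S" "x \<notin> \<tau>" "insert x \<tau> \<notin> S"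
    and "\<And>\<rho>. \<rho> \<subset> insert x \<tau> \<Longrightarrow> \<rho> \<in> S" "c \<subseteq> avoiding (insert x \<tau>) S"
  shows "bd c \<noteq> link_top_faces n \<tau> S"
  using assms
proof (induction \<tau> arbitrary: n S c rule: finite_induct)
  case empty
  have "c \<subseteq> S" using empty by (auto simp: avoiding_def)
  then show ?case using top_faces_not_bd[OF empty.prems(1)] by (simp add: link_top_faces_def)
next
  case (insert v \<tau>)
  note cpx = homology_sphere_complex[OF insert.prems(1)]
  let ?\<tau> = "insert v \<tau>" and ?\<sigma> = "insert x \<tau>"
  let ?z = "link_top_faces n ?\<tau> S"
  have xv: "x \<noteq> v" "x \<notin> \<tau>" using insert.prems by auto
  have v: "{v} \<in> S" using insert.prems(4)[of "{v}"] xv by auto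
  have "v \<notin> ?\<sigma>" using xv insert.hyps by simp
  have \<sigma>: "?\<sigma> \<in> S" using \<open>v \<notin> ?\<sigma>\<close> by (intro insert.prems(4)) blast
  obtain n' where n': "n = Suc n'" and L: "homology_sphere n' (lk v S)"
    using homology_sphere_lk[OF insert.prems(1) v] .
  have z_eq: "?z = link_top_faces n' \<tau> (lk v S)"
    using link_top_faces_insert[OF insert.hyps] n' by simp
  show ?case
  proof
    assume c: "bd c = ?z"
    have z_S: "?z \<subseteq> avoiding (insert x ?\<tau>) S"
      using link_top_faces_avoiding[OF cpx insert.prems(3)] .
    have fin: "finite c" "finite ?z" "finite (cone v ?z)"
      using finite_subset[OF insert.prems(5)] finite_subset[OF z_S]
        simplicial_complexD(1)[OF simplicial_complex_avoiding[OF cpx]]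
      by (auto simp: cone_def)
    have vz: "\<forall>F\<in>?z. v \<notin> F" by (auto simp: link_top_faces_def)
    have vc: "\<forall>F\<in>c. v \<notin> F" using insert.prems(5) by (auto simp: avoiding_def)
    have bz: "bd ?z = {}" using bd_bd[OF fin(1)] c by simp
    let ?w = "sym_diff c (cone v ?z)"
    have "bd ?w = {}"
      using bd_sym_diff[OF fin(1,3)] c bd_cone_cycle[OF vz bz] by simp
    moreover have "cone v ?z \<subseteq> avoiding ?\<sigma> S"
    proof
      fix A assume "A \<in> cone v ?z"
      then obtain F where F: "F \<in> ?z" "A = insert v F" by (auto simp: cone_def)
      then have "A \<in> S"
        using simplicial_complexD(4)[OF cpx, of "F \<union> ?\<tau>" A] by (auto simp: link_top_faces_def)
      moreover have "F \<inter> ?\<sigma> = {}" using F(1) z_S by (auto simp: avoiding_def)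
      then have "A \<inter> ?\<sigma> = {}" using F(2) xv insert.hyps by auto
      ultimately show "A \<in> avoiding ?\<sigma> S" by (simp add: avoiding_def)
    qed
    moreover have "c \<subseteq> avoiding ?\<sigma> S" using insert.prems(5) by (auto simp: avoiding_def)
    ultimately have w: "?w \<subseteq> avoiding ?\<sigma> S" "bd ?w = {}" by blast+
    obtain e where e: "e \<subseteq> avoiding ?\<sigma> S" "bd e = ?w"
      using acyclic_complexD[OF acyclic_avoiding_face[OF insert.prems(1) \<sigma> insert_not_empty] w]
      by (elim exE conjE) (rule that)
    have "lk v c = {}" using vc by (simp only: lk_empty_iff)
    then have lkw: "lk v ?w = ?z" by (simp only: lk_sym_diff lk_cone[OF vz]) simp
    have "bd (lk v e) = lk v (bd e)" by (rule lk_bd[symmetric])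
    also have "\<dots> = ?z" by (simp only: e(2) lkw)
    finally have "bd (lk v e) = ?z" .
    then have "bd (lk v e) = link_top_faces n' \<tau> (lk v S)" using z_eq by (rule trans)
    moreover have "bd (lk v e) \<noteq> link_top_faces n' \<tau> (lk v S)"
    proof (rule insert.IH[OF L xv(2)])
      show "?\<sigma> \<notin> lk v S" using insert.prems(3) by (simp add: lk_def insert_commute)
      show "lk v e \<subseteq> avoiding ?\<sigma> (lk v S)"
        using lk_mono[OF e(1), of v] lk_avoiding[OF \<open>v \<notin> ?\<sigma>\<close>] by simp
      fix \<rho> assume \<rho>: "\<rho> \<subset> ?\<sigma>"
      then have "v \<notin> \<rho>" using \<open>v \<notin> ?\<sigma>\<close> by blast
      then have "insert v \<rho> \<noteq> insert v ?\<sigma>"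
        using insert_ident[OF _ \<open>v \<notin> ?\<sigma>\<close>] \<rho> by blast
      moreover have "insert v ?\<sigma> = insert x ?\<tau>" by (rule insert_commute)
      moreover have "insert v \<rho> \<subseteq> insert v ?\<sigma>"
        using \<rho> by (intro insert_mono psubset_imp_subset)
      ultimately have "insert v \<rho> \<subset> insert x ?\<tau>" by (simp only: psubset_eq) simp
      then have "insert v \<rho> \<in> S" by (rule insert.prems(4))
      then show "\<rho> \<in> lk v S" using \<open>v \<notin> \<rho>\<close> by (simp add: lk_def)
    qed
    ultimately show False by contradiction
  qed
qed

text \<open>
  Take a face \<open>\<sigma>\<close> of \<open>S\<close> of least size that is not a face of \<open>S'\<close>.  As \<open>\<sigma>\<close> has more than \<open>m\<close> vertices, the
  fundamental cycle of the link in \<open>S'\<close> of a facet of \<open>\<sigma>\<close> lives on sets with at most \<open>m - 1\<close> elements.  It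
  bounds in \<open>S\<close> off \<open>\<sigma>\<close>, by a chain on sets with at most \<open>m\<close> elements.  That chain
  lies in \<open>S'\<close> as well, although the cycle does not bound there.
\<close>

lemma homology_sphere_determined_by_half_skeleton:
  assumes S: "homology_sphere (2 * m - 1) S" and S': "homology_sphere (2 * m - 1) S'"
    and skel: "\<And>F. card F \<le> m \<Longrightarrow> F \<in> S \<longleftrightarrow> F \<in> S'"
  shows "S \<subseteq> S'"
proof (rule ccontr)
  assume "\<not> S \<subseteq> S'"
  then have "\<exists>\<sigma>. \<sigma> \<in> S \<and> \<sigma> \<notin> S'" by blast
  then obtain \<sigma> where \<sigma>: "\<sigma> \<in> S" "\<sigma> \<notin> S'"
    and min: "\<And>\<rho>. \<rho> \<in> S \<Longrightarrow> card \<rho> < card \<sigma> \<Longrightarrow> \<rho> \<in> S'"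
    using arg_min_natI[of "\<lambda>\<sigma>. \<sigma> \<in> S \<and> \<sigma> \<notin> S'" _ card] arg_min_nat_le
    by (metis (mono_tags, lifting) not_le)
  note cpx = homology_sphere_complex[OF S] and cpx' = homology_sphere_complex[OF S']
  have fin\<sigma>: "finite \<sigma>" using simplicial_complexD(3)[OF cpx] \<sigma> by blast
  have proper: "\<rho> \<in> S'" if "\<rho> \<subset> \<sigma>" for \<rho>
    using min[of \<rho>] that simplicial_complexD(4)[OF cpx \<sigma>(1)] psubset_card_mono[OF fin\<sigma>] by blast
  have "\<sigma> \<noteq> {}" using \<sigma> simplicial_complexD(2)[OF cpx'] by auto
  then obtain x where x: "x \<in> \<sigma>" by blast
  define \<tau> where "\<tau> = \<sigma> - {x}"
  have \<sigma>_eq: "insert x \<tau> = \<sigma>" "x \<notin> \<tau>" and fin\<tau>: "finite \<tau>"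
    using x fin\<sigma> by (auto simp: \<tau>_def)
  have "m < card \<sigma>" using skel[of \<sigma>] \<sigma> by (meson not_le)
  then have card\<tau>: "m \<le> card \<tau>" using \<sigma>_eq fin\<tau> by auto
  define z where "z = link_top_faces (2 * m - 1) \<tau> S'"
  have \<tau>_S': "\<tau> \<in> S'" using proper[of \<tau>] \<sigma>_eq by blast
  have bz: "bd z = {}" using bd_link_top_faces[OF fin\<tau> S' \<tau>_S'] by (simp add: z_def)
  have z_S': "z \<subseteq> avoiding \<sigma> S'"
    using link_top_faces_avoiding[OF cpx', of x \<tau>] \<sigma> \<sigma>_eq by (simp add: z_def)
  have z_card: "card F + card \<tau> = 2 * m - 1" if "F \<in> z" for F
    using that by (simp add: z_def link_top_faces_def)
  have z_S: "z \<subseteq> avoiding \<sigma> S"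
  proof
    fix F assume F: "F \<in> z"
    then have "card F \<le> m" using z_card[OF F] card\<tau> by linarith
    then show "F \<in> avoiding \<sigma> S" using z_S' F skel by (auto simp: avoiding_def)
  qed
  obtain e where e: "e \<subseteq> avoiding \<sigma> S" "bd e = z"
    using acyclic_complexD[OF acyclic_avoiding_face[OF S \<sigma>(1) \<open>\<sigma> \<noteq> {}\<close>] z_S bz] by blast
  \<comment> \<open>only this homogeneous part of \<open>e\<close> contributes to \<open>z\<close>, and it lies in the common skeleton\<close>
  define e' where "e' = {F \<in> e. card F + card \<tau> = 2 * m}"
  have "m \<noteq> 0" using S' \<sigma> simplicial_complexD(2)[OF cpx'] skel[of \<sigma>] S
    by (cases m) auto
  have "e' \<subseteq> avoiding \<sigma> S'"
  proof
    fix F assume F: "F \<in> e'"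
    then have "card F \<le> m" using card\<tau> by (auto simp: e'_def)
    then show "F \<in> avoiding \<sigma> S'" using F e(1) skel by (auto simp: avoiding_def e'_def)
  qed
  moreover have "bd e' = z"
  proof -
    have fin: "finite F" if "F \<in> e" for F
      using that e(1) simplicial_complexD(3)[OF cpx] by (auto simp: avoiding_def)
    have eq: "cofacets F e' = (if card F + card \<tau> = 2 * m - 1 then cofacets F e else {})" for F
    proof -
      have "card (insert v F) = Suc (card F)" if "v \<notin> F" "insert v F \<in> e" for v
        using that fin[OF that(2)] by simp
      then show ?thesis using \<open>m \<noteq> 0\<close> by (auto simp: cofacets_def e'_def)
    qed
    have "F \<in> bd e' \<longleftrightarrow> card F + card \<tau> = 2 * m - 1 \<and> F \<in> bd e" for F
      by (simp add: bd_def eq)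
    then show ?thesis using e(2) z_card by auto
  qed
  moreover have "bd e' \<noteq> z"
    unfolding z_def
  proof (rule missing_face_links_nontrivially[OF fin\<tau> S' \<sigma>_eq(2)])
    show "insert x \<tau> \<notin> S'" using \<sigma> \<sigma>_eq by simp
    show "\<rho> \<in> S'" if "\<rho> \<subset> insert x \<tau>" for \<rho> using that proper \<sigma>_eq by simp
    show "e' \<subseteq> avoiding (insert x \<tau>) S'" using calculation \<sigma>_eq by simp
  qed
  ultimately show False by blast
qed

section \<open>From homology manifolds to homology spheres\<close>

lemma mem_link_iff: "F \<in> link G X \<longleftrightarrow> F \<inter> G = {} \<and> F \<union> G \<in> X"
proof
  assume "F \<in> link G X"
  then obtain A where A: "F = A - G" "A \<in> X" "G \<subseteq> A" by (auto simp: link_def)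
  then have "F \<union> G = A" by blast
  then show "F \<inter> G = {} \<and> F \<union> G \<in> X" using A by auto
next
  assume *: "F \<inter> G = {} \<and> F \<union> G \<in> X"
  then have "F = (F \<union> G) - G" by blast
  then show "F \<in> link G X" using * unfolding link_def by blast
qed

lemma lk_link:
  assumes "v \<notin> G"
  shows "lk v (link G X) = link (insert v G) X"
proof -
  have "F \<in> lk v (link G X) \<longleftrightarrow> F \<in> link (insert v G) X" for F
  proof -
    have "insert v F \<union> G = F \<union> insert v G" by auto
    then show ?thesis using assms by (simp add: lk_def mem_link_iff)
  qed
  then show ?thesis by blast
qed

lemma simplicial_complex_link:
  assumes "simplicial_complex X" "G \<in> X"
  shows "simplicial_complex (link G X)"
proof -
  have sub: "link G X \<subseteq> X"
    using simplicial_complexD(4)[OF assms(1)] by (auto simp: mem_link_iff)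
  have "E \<in> link G X" if "F \<in> link G X" "E \<subseteq> F" for E F
    using that simplicial_complexD(4)[OF assms(1), of "F \<union> G" "E \<union> G"]
    by (auto simp: mem_link_iff)
  moreover have "finite (link G X)"
    using sub simplicial_complexD(1)[OF assms(1)] finite_subset by blast
  moreover have "{} \<in> link G X" using assms(2) by (simp add: mem_link_iff)
  moreover have "\<forall>F\<in>link G X. finite F" using sub simplicial_complexD(3)[OF assms(1)] by blast
  ultimately show ?thesis unfolding simplicial_complex_def by blast
qed

lemma faces_eq_faces_of_size:
  "faces (int p) X = faces_of_size (Suc p) X" "faces (int p - 1) X = faces_of_size p X"
  by (auto simp: faces_def face_dim_def)

lemma card_cofacets:
  assumes "finite F" "\<And>G. G \<in> c \<Longrightarrow> card G = Suc (card F)"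
  shows "card {G \<in> c. F \<subseteq> G} = card (cofacets F c)"
proof -
  have "{G \<in> c. F \<subseteq> G} = (\<lambda>v. insert v F) ` cofacets F c"
  proof
    show "{G \<in> c. F \<subseteq> G} \<subseteq> (\<lambda>v. insert v F) ` cofacets F c"
    proof
      fix G assume "G \<in> {G \<in> c. F \<subseteq> G}"
      then have G: "G \<in> c" "F \<subseteq> G" "card G = Suc (card F)" using assms by auto
      then have "card (G - F) = 1" using assms(1) by (simp add: card_Diff_subset)
      then obtain v where "G - F = {v}" by (rule card_1_singletonE)
      then have "G = insert v F" "v \<notin> F" using G by auto
      then show "G \<in> (\<lambda>v. insert v F) ` cofacets F c" using G by (auto simp: cofacets_def)
    qed
  qed (auto simp: cofacets_def)
  moreover have "inj_on (\<lambda>v. insert v F) (cofacets F c)"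
    by (auto simp: inj_on_def cofacets_def)
  ultimately show ?thesis by (simp add: card_image)
qed

text \<open>
  The unreduced boundary differs from the reduced one in the empty face only, which matters for
  chains of vertices.
\<close>

lemma boundary_eq_bd:
  assumes K: "simplicial_complex K" and c: "c \<subseteq> faces_of_size (Suc p) K"
  shows "boundary K (int p) c = bd c - {{}}"
proof -
  have fin: "finite F" if "F \<in> K" for F using that simplicial_complexD(3)[OF K] by blast
  have card_eq: "card {G \<in> c. F \<subseteq> G} = card (cofacets F c)" if F: "card F = p" "F \<in> K" for F
    using card_cofacets[of F c] F fin[OF F(2)] c by auto
  have "F \<in> faces_of_size p K" if "F \<in> bd c" for F
  proof -
    from that obtain v where v: "v \<notin> F" "insert v F \<in> c" by (rule bdE)
    then have I: "insert v F \<in> K" "card (insert v F) = Suc p" using c by auto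
    then have "F \<in> K" using simplicial_complexD(4)[OF K I(1)] by blast
    then show ?thesis using I(2) v(1) fin by simp
  qed
  note top = this
  have "F \<in> boundary K (int p) c \<longleftrightarrow> F \<in> bd c - {{}}" for F
  proof (cases "F \<in> faces_of_size p K")
    case True
    then show ?thesis using card_eq[of F] by (auto simp: boundary_def faces_eq_faces_of_size bd_def)
  next
    case False
    then show ?thesis using top[of F] by (auto simp: boundary_def faces_eq_faces_of_size)
  qed
  then show ?thesis by blast
qed

definition cosets_mod :: "'a set set set \<Rightarrow> 'a set set \<Rightarrow> 'a set set set" where
  "cosets_mod B c = (\<lambda>b. sym_diff b c) ` B"

lemma mem_own_coset:
  assumes "{} \<in> B"
  shows "c \<in> cosets_mod B c"
proof -
  have "c = sym_diff {} c" by simp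
  then show ?thesis using assms unfolding cosets_mod_def by (rule image_eqI)
qed

lemma carrier_homology:
  "carrier (homology_Z2 i K) = cosets_mod (boundaries K i) ` cycles K i"
  by (simp add: homology_Z2_def FactGroup_def RCOSETS_def r_coset_def chain_group_def
      cosets_mod_def UNION_singleton_eq_range)

lemma cycles_eq:
  assumes "simplicial_complex K"
  shows "cycles K (int p) = {c. c \<subseteq> faces_of_size (Suc p) K \<and> bd c \<subseteq> {{}}}"
proof -
  have "c \<in> cycles K (int p) \<longleftrightarrow> c \<subseteq> faces_of_size (Suc p) K \<and> boundary K (int p) c = {}" for c
  proof -
    have "faces_of_size (Suc p) K - {{}} = faces_of_size (Suc p) K" by auto
    then show ?thesis by (simp add: cycles_def kernel_def chain_group_def faces_eq_faces_of_size)
  qed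
  also have "c \<subseteq> faces_of_size (Suc p) K \<and> boundary K (int p) c = {} \<longleftrightarrow>
      c \<subseteq> faces_of_size (Suc p) K \<and> bd c \<subseteq> {{}}" for c
    using boundary_eq_bd[OF assms, of c p] by (intro conj_cong refl) simp
  finally show ?thesis by (simp add: set_eq_iff[of "cycles K (int p)"])
qed

lemma boundaries_eq:
  assumes "simplicial_complex K"
  shows "boundaries K (int p) = bd ` Pow (faces_of_size (Suc (Suc p)) K)"
proof -
  have "boundary K (int p + 1) e = bd e" if "e \<subseteq> faces_of_size (Suc (Suc p)) K" for e
  proof -
    have "{} \<notin> bd e" using that by (auto elim!: bdE)
    moreover have "boundary K (int (Suc p)) e = bd e - {{}}"
      using boundary_eq_bd[OF assms, of e "Suc p"] that by simp
    ultimately show ?thesis by (simp add: add.commute)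
  qed
  moreover have "carrier (chain_group K (int p + 1)) = Pow (faces_of_size (Suc (Suc p)) K)"
    using faces_eq_faces_of_size(1)[of "Suc p" K] by (auto simp: chain_group_def add.commute)
  ultimately show ?thesis unfolding boundaries_def by (auto intro!: image_cong)
qed

lemma card_carrier_Z2:
  assumes "H \<cong> integer_mod_group 2"
  shows "card (carrier H) = 2"
proof -
  obtain h where "bij_betw h (carrier H) (carrier (integer_mod_group 2))"
    using assms by (auto simp: is_iso_def iso_def)
  then have "card (carrier H) = card {0..<int 2}"
    using bij_betw_same_card by (fastforce simp: carrier_integer_mod_group)
  then show ?thesis by simp
qed

lemma not_three_of_card_2:
  assumes "card A = 2" "x \<in> A" "y \<in> A" "z \<in> A" "x \<noteq> y" "x \<noteq> z"
  shows "y = z"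
proof (rule ccontr)
  assume "y \<noteq> z"
  then have "card {x, y, z} = 3" using assms by simp
  moreover have "card {x, y, z} \<le> card A"
    using assms by (intro card_mono) (auto intro: card_ge_0_finite)
  ultimately show False using assms(1) by simp
qed

lemma bounding_if_homology_trivial:
  assumes K: "simplicial_complex K" and H: "trivial_group (homology_Z2 (int p) K)"
    and c: "c \<subseteq> faces_of_size (Suc p) K" "bd c = {}"
  shows "\<exists>e\<subseteq>K. bd e = c"
proof -
  have "c \<in> cycles K (int p)" using c cycles_eq[OF K] by auto
  moreover have "one (homology_Z2 (int p) K) = boundaries K (int p)"
    by (simp add: homology_Z2_def FactGroup_def)
  ultimately have "cosets_mod (boundaries K (int p)) c = boundaries K (int p)"
    using H carrier_homology[of "int p" K] by (auto simp: trivial_group_def)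
  moreover have "{} \<in> boundaries K (int p)"
    unfolding boundaries_eq[OF K] by (rule image_eqI[of _ _ "{}"]) simp_all
  then have "c \<in> cosets_mod (boundaries K (int p)) c"
    by (rule mem_own_coset)
  ultimately have "c \<in> bd ` Pow (faces_of_size (Suc (Suc p)) K)" using boundaries_eq[OF K] by metis
  then obtain e where "e \<subseteq> faces_of_size (Suc (Suc p)) K" "bd e = c" by blast
  then show ?thesis by blast
qed

text \<open>
  Unreduced homology of order two in degree zero means that a reduced cycle, that is an even set of vertices,
  is a boundary: otherwise its class, the trivial class and the class of a single vertex would be three
  distinct elements.
\<close>

lemma bounding_in_degree_zero:
  assumes K: "simplicial_complex K" and v: "{v} \<in> K"
    and H: "homology_Z2 0 K \<cong> integer_mod_group 2"
    and c: "c \<subseteq> faces_of_size 1 K" "bd c = {}"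
  shows "\<exists>e\<subseteq>K. bd e = c"
proof (rule ccontr)
  assume nb: "\<not> (\<exists>e\<subseteq>K. bd e = c)"
  have fin: "finite (faces_of_size n K)" for n using simplicial_complexD(1)[OF K] by simp
  define B where "B = boundaries K 0"
  have B_eq: "B = bd ` Pow (faces_of_size 2 K)"
    unfolding B_def using boundaries_eq[OF K, of 0] by (simp add: numeral_2_eq_2)
  have B_even: "bd b = {}" "finite b" if b: "b \<in> B" for b
  proof -
    obtain e where e: "e \<subseteq> faces_of_size 2 K" "b = bd e" using b B_eq by blast
    have fe: "finite e" by (rule finite_subset[OF e(1) fin])
    have "bd e \<subseteq> K" using e(1) by (intro bd_subset_complex[OF K]) blast
    then show "finite b" using e(2) simplicial_complexD(1)[OF K] finite_subset by blast
    show "bd b = {}" unfolding e(2) by (rule bd_bd[OF fe])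
  qed
  have B0: "{} \<in> B" unfolding B_eq by (rule image_eqI[of _ _ "{}"]) simp_all
  have in_carrier: "cosets_mod B a \<in> carrier (homology_Z2 0 K)" if a: "a \<subseteq> faces_of_size 1 K" for a
  proof -
    have "bd a \<subseteq> {{}}"
    proof
      fix F assume "F \<in> bd a"
      then obtain v where v: "v \<notin> F" "insert v F \<in> a" by (rule bdE)
      then have "card (insert v F) = 1" using a by auto
      then obtain u where "insert v F = {u}" by (rule card_1_singletonE)
      then show "F \<in> {{}}" using v(1) by auto
    qed
    then have "a \<in> cycles K 0" using a cycles_eq[OF K, of 0] by simp
    then show ?thesis unfolding carrier_homology B_def by (rule imageI)
  qed
  have coset_even: "bd a = {}" if a: "a \<in> cosets_mod B b" and b: "bd b = {}" "finite b" for a b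
  proof -
    obtain b' where b': "b' \<in> B" "a = sym_diff b' b" using a by (auto simp: cosets_mod_def)
    have "bd a = sym_diff (bd b') (bd b)"
      unfolding b'(2) by (rule bd_sym_diff[OF B_even(2)[OF b'(1)] b(2)])
    then show ?thesis using B_even(1)[OF b'(1)] b(1) by simp
  qed
  \<comment> \<open>a single vertex is a cycle of odd size, so its class differs from that of any even cycle\<close>
  have odd: "bd {{v}} \<noteq> {}"
  proof -
    have "cofacets {} {{v}} = {v}" by (auto simp: cofacets_def)
    then have "{} \<in> bd {{v}}" by (simp add: bd_def)
    then show ?thesis by blast
  qed
  have fc: "finite c" by (rule finite_subset[OF c(1) fin])
  have "cosets_mod B {{v}} \<noteq> cosets_mod B c"
  proof
    assume "cosets_mod B {{v}} = cosets_mod B c"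
    then have "{{v}} \<in> cosets_mod B c" using mem_own_coset[OF B0, of "{{v}}"] by simp
    then show False using coset_even[OF _ c(2) fc] odd by blast
  qed
  moreover have "cosets_mod B {{v}} \<noteq> cosets_mod B {}"
  proof
    assume "cosets_mod B {{v}} = cosets_mod B {}"
    then have "{{v}} \<in> cosets_mod B {}" using mem_own_coset[OF B0, of "{{v}}"] by simp
    then show False using coset_even[OF _ bd_empty finite.emptyI] odd by blast
  qed
  ultimately have "cosets_mod B c = cosets_mod B {}"
    using not_three_of_card_2[OF card_carrier_Z2[OF H] in_carrier in_carrier[OF c(1)] in_carrier,
        of "{{v}}" "{}"] v by simp
  then have "c \<in> cosets_mod B {}" using mem_own_coset[OF B0, of c] by simp
  then have "c \<in> B" by (simp add: cosets_mod_def)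
  then show False using nb B_eq by blast
qed

text \<open>
  In the top degree there are no boundaries, so homology of order two leaves only two cycles.
\<close>

lemma top_cycle_unique:
  assumes K: "simplicial_complex K" and dim: "\<And>F. F \<in> K \<Longrightarrow> card F \<le> Suc p"
    and H: "homology_Z2 (int p) K \<cong> integer_mod_group 2"
    and Z: "faces_of_size (Suc p) K \<noteq> {}" "bd (faces_of_size (Suc p) K) = {}"
    and c: "c \<subseteq> faces_of_size (Suc p) K" "bd c = {}"
  shows "c = {} \<or> c = faces_of_size (Suc p) K"
proof -
  have no_face: "faces_of_size (Suc (Suc p)) K = {}" using dim by force
  then have B: "boundaries K (int p) = {{}}" unfolding boundaries_eq[OF K] no_face by simp
  have "{a} \<in> carrier (homology_Z2 (int p) K)" if "a \<subseteq> faces_of_size (Suc p) K" "bd a = {}" for a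
  proof -
    have "a \<in> cycles K (int p)" using that cycles_eq[OF K, of p] by simp
    then have "cosets_mod {{}} a \<in> carrier (homology_Z2 (int p) K)"
      unfolding carrier_homology B by (rule imageI)
    then show ?thesis by (simp add: cosets_mod_def)
  qed
  note m = this[OF _ bd_empty] this[OF _ Z(2)] this[OF c]
  show ?thesis
    using not_three_of_card_2[OF card_carrier_Z2[OF H], of "{c}" "{{}}" "{faces_of_size (Suc p) K}"] m Z(1)
    by auto
qed

text \<open>
  Whether \<open>F\<close> lies in the boundary of a chain depends only on the members of the chain with one vertex
  more than \<open>F\<close>.  Hence the homogeneous parts of a cycle are cycles, and bounding chains of these parts can
  be glued by keeping from each of them the faces of the right size.
\<close>

lemma cycle_decomposition_from_graded:
  assumes K: "simplicial_complex K" and dim: "\<And>F. F \<in> K \<Longrightarrow> card F \<le> t"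
    and low: "\<And>i c. i < t \<Longrightarrow> c \<subseteq> faces_of_size i K \<Longrightarrow> bd c = {} \<Longrightarrow> \<exists>e\<subseteq>K. bd e = c"
    and top: "\<And>c. c \<subseteq> faces_of_size t K \<Longrightarrow> bd c = {} \<Longrightarrow> c = {} \<or> c = faces_of_size t K"
    and z: "z \<subseteq> K" "bd z = {}"
  shows "\<exists>e\<subseteq>K. z = bd e \<or> z = sym_diff (bd e) (faces_of_size t K)"
proof -
  have fin: "finite F" if "F \<in> K" for F using that simplicial_complexD(3)[OF K] by blast
  have card_coface: "card (insert v F) = Suc (card F)" if "v \<notin> F" "insert v F \<in> K" for v F
    using that fin[OF that(2)] by simp
  define zi where "zi i = {F \<in> z. card F = i}" for i
  have zi: "bd (zi i) = {}" "zi i \<subseteq> faces_of_size i K" for i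
  proof -
    have "cofacets F (zi i) = (if Suc (card F) = i then cofacets F z else {})" for F
      using card_coface z(1) by (auto simp: cofacets_def zi_def)
    then have "F \<in> bd (zi i) \<Longrightarrow> F \<in> bd z" for F by (simp add: bd_def split: if_splits)
    then show "bd (zi i) = {}" using z(2) by blast
    show "zi i \<subseteq> faces_of_size i K" using z(1) by (auto simp: zi_def)
  qed
  \<comment> \<open>\<open>E i\<close> bounds the homogeneous part of size \<open>i\<close>; of it, the faces of size \<open>i + 1\<close> enter \<open>e\<close>\<close>
  define E where "E i = (SOME e. e \<subseteq> K \<and> bd e = zi i)" for i
  have E: "E i \<subseteq> K \<and> bd (E i) = zi i" if "i < t" for i
    using someI_ex[OF low[OF that zi(2,1)]] by (simp add: E_def)
  define e where "e = {F \<in> K. F \<noteq> {} \<and> F \<in> E (card F - 1)}"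
  have cof: "cofacets F e = (if card F < t then cofacets F (E (card F)) else {})" for F
  proof -
    have "v \<in> cofacets F e \<longleftrightarrow> card F < t \<and> v \<in> cofacets F (E (card F))" for v
    proof (cases "v \<notin> F \<and> insert v F \<in> K")
      case True
      then show ?thesis using card_coface[of v F] dim[of "insert v F"]
        by (auto simp: cofacets_def e_def)
    next
      case False
      then have "v \<notin> cofacets F e" by (auto simp: cofacets_def e_def)
      moreover have "v \<notin> cofacets F (E (card F))" if "card F < t"
        using False E[OF that] by (auto simp: cofacets_def)
      ultimately show ?thesis by simp
    qed
    then show ?thesis by auto
  qed
  have bde: "bd e = {F \<in> z. card F < t}"
  proof -
    have "F \<in> bd e \<longleftrightarrow> card F < t \<and> F \<in> bd (E (card F))" for F
      by (simp add: bd_def cof)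
    moreover have "bd (E (card F)) = {G \<in> z. card G = card F}" if "card F < t" for F
      using E[OF that] by (simp add: zi_def)
    ultimately show ?thesis by auto
  qed
  have "z = sym_diff (bd e) (zi t)"
  proof -
    have "card F < t \<or> card F = t" if "F \<in> z" for F
      using dim[of F] that z(1) by (auto simp: le_less)
    then have "z = bd e \<union> zi t" "bd e \<inter> zi t = {}" unfolding bde zi_def by auto
    then show ?thesis by blast
  qed
  moreover have "e \<subseteq> K" by (auto simp: e_def)
  ultimately show ?thesis using top[OF zi(2,1)] by auto
qed

lemma pseudomanifoldD:
  assumes "pseudomanifold n L"
  shows "simplicial_complex L"
    and "F \<in> L \<Longrightarrow> int (card F) \<le> n + 1"
    and "F \<in> L \<Longrightarrow> \<exists>G\<in>L. int (card G) = n + 1 \<and> F \<subseteq> G"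
    and "F \<in> L \<Longrightarrow> int (card F) = n \<Longrightarrow> card {G \<in> L. int (card G) = n + 1 \<and> F \<subseteq> G} = 2"
proof -
  show cpx: "simplicial_complex L" using assms unfolding pseudomanifold_def by (elim conjE)
  have dim: "complex_dim L = n" using assms unfolding pseudomanifold_def by (elim conjE)
  have pure: "\<forall>F\<in>L. \<exists>G\<in>faces n L. F \<subseteq> G"
    using assms unfolding pseudomanifold_def by (elim conjE)
  have two: "\<forall>F\<in>faces (n - 1) L. card {G \<in> faces n L. F \<subseteq> G} = 2"
    using assms unfolding pseudomanifold_def by (elim conjE)
  have faces: "G \<in> faces n L \<longleftrightarrow> G \<in> L \<and> int (card G) = n + 1" for G
    unfolding faces_def face_dim_def by force
  show "int (card F) \<le> n + 1" if "F \<in> L"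
  proof -
    have "face_dim F \<le> Max (face_dim ` L)"
      using that simplicial_complexD(1)[OF cpx] by (intro Max_ge) auto
    then show ?thesis using dim by (simp add: complex_dim_def face_dim_def)
  qed
  show "\<exists>G\<in>L. int (card G) = n + 1 \<and> F \<subseteq> G" if "F \<in> L"
    using bspec[OF pure that] unfolding Bex_def faces by blast
  show "card {G \<in> L. int (card G) = n + 1 \<and> F \<subseteq> G} = 2" if F: "F \<in> L" "int (card F) = n"
  proof -
    have "F \<in> faces (n - 1) L" using F by (simp add: faces_def face_dim_def)
    then have "card {G \<in> faces n L. F \<subseteq> G} = 2" using two by blast
    then show ?thesis by (simp only: faces conj_assoc)
  qed
qed

text \<open>
  The pseudomanifold condition, read inside the link of \<open>G\<close>.
\<close>

lemma card_link_cofacets: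
  assumes L: "pseudomanifold n L" and dim: "int (Suc t) + int (card G) = n + 1"
    and F: "F \<in> link G L" "card F = t"
  shows "card (cofacets F (faces_of_size (Suc t) (link G L))) = 2"
proof -
  note cpx = pseudomanifoldD(1)[OF L]
  let ?E = "F \<union> G"
  have E: "?E \<in> L" "F \<inter> G = {}" using F(1) by (auto simp: mem_link_iff)
  have fin: "finite ?E" by (rule simplicial_complexD(3)[OF cpx E(1)])
  have cE: "card ?E = t + card G" using card_Un_disjoint[of F G] fin E(2) F(2) by simp
  have "cofacets ?E {A \<in> L. int (card A) = n + 1} = cofacets F (faces_of_size (Suc t) (link G L))"
  proof -
    have "v \<in> cofacets ?E {A \<in> L. int (card A) = n + 1} \<longleftrightarrow>
        v \<in> cofacets F (faces_of_size (Suc t) (link G L))" for v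
    proof (cases "v \<in> ?E")
      case True
      then show ?thesis by (auto simp: cofacets_def mem_link_iff)
    next
      case False
      have "card (insert v ?E) = Suc (card ?E)" "card (insert v F) = Suc t"
        using False fin F(2) by simp_all
      moreover have "insert v F \<inter> G = {}" using False E(2) by auto
      moreover have "insert v F \<union> G = insert v ?E" by simp
      ultimately show ?thesis using False dim cE by (simp add: cofacets_def mem_link_iff)
    qed
    then show ?thesis by blast
  qed
  moreover have "card (cofacets ?E {A \<in> L. int (card A) = n + 1}) = 2"
  proof -
    have "int (card ?E) = n" using cE dim by simp
    then have "card {A \<in> {A \<in> L. int (card A) = n + 1}. ?E \<subseteq> A} = 2"
      using pseudomanifoldD(4)[OF L E(1)] by simp
    moreover have "card A = Suc (card ?E)" if "A \<in> {A \<in> L. int (card A) = n + 1}" for A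
      using that cE dim by auto
    ultimately show ?thesis using card_cofacets[OF fin] by metis
  qed
  ultimately show ?thesis by simp
qed

lemma cofacets_empty:
  assumes c: "c \<subseteq> faces_of_size 1 K"
  shows "c = (\<lambda>v. {v}) ` cofacets {} c"
proof
  show "c \<subseteq> (\<lambda>v. {v}) ` cofacets {} c"
  proof
    fix F assume F: "F \<in> c"
    then have "card F = 1" using c by blast
    then obtain v where "F = {v}" by (rule card_1_singletonE)
    then show "F \<in> (\<lambda>v. {v}) ` cofacets {} c" using F by (simp add: cofacets_def)
  qed
qed (auto simp: cofacets_def)

text \<open>
  Two situations are not covered by the homological hypothesis on links and are settled by the
  definition of a pseudomanifold: the link of a facet consists of the empty face, and the link of a ridge of
  two points.
\<close>

lemma homology_manifold_link_sphere:
  assumes M: "homology_manifold n L"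
  shows "\<lbrakk>G \<in> L; G \<noteq> {}; int t + int (card G) = n + 1\<rbrakk> \<Longrightarrow> homology_sphere t (link G L)"
proof (induction t arbitrary: G)
  case 0
  have L: "pseudomanifold n L" using M by (simp add: homology_manifold_def)
  have "F = {}" if "F \<in> link G L" for F
  proof -
    have F: "F \<union> G \<in> L" "F \<inter> G = {}" using that by (auto simp: mem_link_iff)
    have "finite (F \<union> G)" by (rule simplicial_complexD(3)[OF pseudomanifoldD(1)[OF L] F(1)])
    then have "card (F \<union> G) = card F + card G" "finite F"
      using card_Un_disjoint[of F G] F(2) by auto
    then show ?thesis using pseudomanifoldD(2)[OF L F(1)] 0 by simp
  qed
  moreover have "{} \<in> link G L" using 0 by (simp add: mem_link_iff)
  ultimately show ?case by (simp only: homology_sphere.simps) blast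
next
  case (Suc t)
  have L: "pseudomanifold n L" using M by (simp add: homology_manifold_def)
  note cpxL = pseudomanifoldD(1)[OF L]
  define K where "K = link G L"
  have cpx: "simplicial_complex K"
    unfolding K_def by (rule simplicial_complex_link[OF cpxL Suc.prems(1)])
  have card_K: "card (F \<union> G) = card F + card G" if "F \<in> K" for F
  proof -
    have F: "F \<union> G \<in> L" "F \<inter> G = {}" using that by (auto simp: K_def mem_link_iff)
    have "finite (F \<union> G)" by (rule simplicial_complexD(3)[OF cpxL F(1)])
    then show ?thesis using card_Un_disjoint[of F G] F(2) by simp
  qed
  have dim: "card F \<le> Suc t" if "F \<in> K" for F
  proof -
    have "F \<union> G \<in> L" using that by (simp add: K_def mem_link_iff)
    then show ?thesis using pseudomanifoldD(2)[OF L] card_K[OF that] Suc.prems(3) by fastforce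
  qed
  have ne: "faces_of_size (Suc t) K \<noteq> {}"
  proof -
    obtain A where A: "A \<in> L" "int (card A) = n + 1" "G \<subseteq> A"
      using pseudomanifoldD(3)[OF L Suc.prems(1)] by blast
    have AG: "(A - G) \<union> G = A" using A(3) by blast
    have "A - G \<in> K" using A(1) AG by (simp add: K_def mem_link_iff Int_commute)
    moreover have "card (A - G) = Suc t"
      using card_K[OF calculation] AG A(2) Suc.prems(3) by simp
    ultimately show ?thesis by blast
  qed
  have cof2: "card (cofacets F (faces_of_size (Suc t) K)) = 2" if "F \<in> K" "card F = t" for F
    unfolding K_def by (rule card_link_cofacets[OF L Suc.prems(3)]) (use that in \<open>simp_all add: K_def\<close>)
  have bd_top: "bd (faces_of_size (Suc t) K) = {}"
  proof (rule ccontr)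
    assume "bd (faces_of_size (Suc t) K) \<noteq> {}"
    then obtain F where F: "F \<in> bd (faces_of_size (Suc t) K)" by blast
    have FK: "F \<in> K" using bd_subset_complex[OF cpx, of "faces_of_size (Suc t) K"] F by blast
    from F obtain v where v: "v \<notin> F" "insert v F \<in> faces_of_size (Suc t) K" by (rule bdE)
    then have "card F = t" using simplicial_complexD(3)[OF cpx FK] by simp
    then show False using cof2[OF FK] F by (simp add: bd_def)
  qed
  obtain v where v: "{v} \<in> K"
  proof -
    obtain F where F: "F \<in> K" "card F = Suc t" using ne by blast
    then have "F \<noteq> {}" by auto
    then obtain v where "v \<in> F" by blast
    then have "{v} \<in> K" by (intro simplicial_complexD(4)[OF cpx F(1)]) simp
    then show ?thesis by (rule that)
  qed
  have sphere: "has_Z2_homology_of_sphere (int t) K" if "t \<ge> 1"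
  proof -
    let ?j = "int (card G) - 1"
    have "finite G" by (rule simplicial_complexD(3)[OF cpxL Suc.prems(1)])
    then have "card G > 0" using Suc.prems(2) by (simp add: card_gt_0_iff)
    moreover have "G \<in> faces ?j L" using Suc.prems(1) by (simp add: faces_def face_dim_def)
    moreover have "n - ?j - 1 = int t" using Suc.prems(3) by simp
    moreover have "\<And>j G. 0 \<le> j \<Longrightarrow> j \<le> n - 1 \<Longrightarrow> G \<in> faces j L \<Longrightarrow> n - j - 1 \<ge> 1 \<Longrightarrow>
        has_Z2_homology_of_sphere (n - j - 1) (link G L)"
      using M by (simp add: homology_manifold_def)
    from this[of ?j G] calculation have "has_Z2_homology_of_sphere (int t) (link G L)"
      using that by simp
    then show ?thesis by (simp add: K_def)
  qed
  have low: "\<exists>e\<subseteq>K. bd e = c" if i: "i < Suc t" and c: "c \<subseteq> faces_of_size i K" "bd c = {}" for i c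
  proof -
    consider "i = 0" | "i = 1" | p where "i = Suc p" "p \<ge> 1" by (cases i) force+
    then show ?thesis
    proof cases
      case 1
      then have "c \<subseteq> {{}}" using c(1) simplicial_complexD(3)[OF cpx] by auto
      then consider "c = {}" | "c = {{}}" by blast
      then show ?thesis
      proof cases
        case 1
        then show ?thesis using bd_empty by blast
      next
        case 2
        have "cofacets F {{v}} = (if F = {} then {v} else {})" for F
          by (auto simp: cofacets_def)
        then have "bd {{v}} = {{}}" by (auto simp: bd_def split: if_splits)
        then show ?thesis using 2 v by (intro exI[of _ "{{v}}"]) simp
      qed
    next
      case 2
      then have "has_Z2_homology_of_sphere (int t) K" using i by (intro sphere) simp
      then have "homology_Z2 0 K \<cong> integer_mod_group 2"
        by (simp add: has_Z2_homology_of_sphere_def)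
      then show ?thesis using bounding_in_degree_zero[OF cpx v] c 2 by simp
    next
      case 3
      then have "has_Z2_homology_of_sphere (int t) K" using i by (intro sphere) simp
      then have "trivial_group (homology_Z2 (int p) K)"
        using 3 i by (simp add: has_Z2_homology_of_sphere_def)
      then show ?thesis using bounding_if_homology_trivial[OF cpx] c 3(1) by blast
    qed
  qed
  have top: "c = {} \<or> c = faces_of_size (Suc t) K" if c: "c \<subseteq> faces_of_size (Suc t) K" "bd c = {}" for c
  proof (cases "t = 0")
    case True
    let ?Z = "faces_of_size (Suc t) K"
    have Z2: "card (cofacets {} ?Z) = 2"
      using cof2[OF simplicial_complexD(2)[OF cpx]] True by simp
    have sub: "cofacets {} c \<subseteq> cofacets {} ?Z" using c(1) by (auto simp: cofacets_def)
    have fin: "finite (cofacets {} ?Z)" using Z2 by (intro card_ge_0_finite) simp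
    have "even (card (cofacets {} c))" using c(2) by (simp add: bd_def)
    moreover have "card (cofacets {} c) \<le> 2" using card_mono[OF fin sub] Z2 by simp
    ultimately have "card (cofacets {} c) = 0 \<or> card (cofacets {} c) = 2" by presburger
    then have "cofacets {} c = {} \<or> cofacets {} c = cofacets {} ?Z"
      using card_subset_eq[OF fin sub] Z2 finite_subset[OF sub fin] by auto
    then show ?thesis
    proof
      have c_eq: "c = (\<lambda>v. {v}) ` cofacets {} c"
        using cofacets_empty[of c K] c(1) True by simp
      assume "cofacets {} c = {}"
      then have "(\<lambda>v. {v}) ` cofacets {} c = {}" by simp
      with c_eq have "c = {}" by (rule trans)
      then show ?thesis by (rule disjI1)
    next
      have c_eq: "c = (\<lambda>v. {v}) ` cofacets {} c" and Z_eq: "?Z = (\<lambda>v. {v}) ` cofacets {} ?Z"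
        using cofacets_empty[of _ K] c(1) True by simp_all
      assume "cofacets {} c = cofacets {} ?Z"
      then have "(\<lambda>v. {v}) ` cofacets {} c = ?Z" using Z_eq by simp
      with c_eq have "c = ?Z" by (rule trans)
      then show ?thesis by (rule disjI2)
    qed
  next
    case False
    then have "has_Z2_homology_of_sphere (int t) K" by (intro sphere) simp
    then have "homology_Z2 (int t) K \<cong> integer_mod_group 2"
      by (simp add: has_Z2_homology_of_sphere_def)
    then show ?thesis using top_cycle_unique[OF cpx dim _ ne bd_top c] by simp
  qed
  have links: "homology_sphere t (lk u K)" if "{u} \<in> K" for u
  proof -
    have u: "u \<notin> G" "insert u G \<in> L" using that by (auto simp: K_def mem_link_iff)
    have "finite G" by (rule simplicial_complexD(3)[OF cpxL Suc.prems(1)])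
    then have "int t + int (card (insert u G)) = n + 1" using u(1) Suc.prems(3) by simp
    then have "homology_sphere t (link (insert u G) L)" by (intro Suc.IH u(2)) simp
    then show ?thesis unfolding K_def lk_link[OF u(1)] .
  qed
  have "\<exists>e\<subseteq>K. z = bd e \<or> z = sym_diff (bd e) (faces_of_size (Suc t) K)"
    if "z \<subseteq> K" "bd z = {}" for z
    by (rule cycle_decomposition_from_graded[OF cpx dim low top that])
  then show ?case
    unfolding K_def[symmetric] homology_sphere.simps
    using cpx dim ne bd_top links by (intro conjI ballI allI impI) assumption+
qed

section \<open>Homology spheres under relabelling of vertices\<close>

text \<open>
  The complexes \<open>X\<close> and \<open>Y\<close> live on different types of vertices.  To compare them, \<open>X\<close> is moved
  along the vertex map, and its link spheres have to move with it.
\<close>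

lemma bd_image:
  assumes f: "inj_on f V" and c: "c \<subseteq> Pow V"
  shows "bd ((`) f ` c) = (`) f ` bd c"
proof -
  have cof: "cofacets (f ` F) ((`) f ` c) = f ` cofacets F c" if F: "F \<subseteq> V" for F
  proof
    show "cofacets (f ` F) ((`) f ` c) \<subseteq> f ` cofacets F c"
    proof
      fix w assume "w \<in> cofacets (f ` F) ((`) f ` c)"
      then obtain A where A: "w \<notin> f ` F" "A \<in> c" "insert w (f ` F) = f ` A"
        by (auto simp: cofacets_def)
      then obtain v where v: "v \<in> A" "w = f v" by blast
      have "A \<subseteq> V" using A(2) c by blast
      moreover have "insert v F \<subseteq> V" using v(1) \<open>A \<subseteq> V\<close> F by blast
      moreover have "f ` insert v F = f ` A" using A(3) v(2) by simp
      ultimately have "insert v F = A" using inj_on_image_eq_iff[OF f] by blast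
      then have "v \<in> cofacets F c" using A v by (auto simp: cofacets_def)
      then show "w \<in> f ` cofacets F c" using v(2) by blast
    qed
    show "f ` cofacets F c \<subseteq> cofacets (f ` F) ((`) f ` c)"
    proof
      fix w assume "w \<in> f ` cofacets F c"
      then obtain v where v: "w = f v" "v \<notin> F" "insert v F \<in> c" by (auto simp: cofacets_def)
      have "v \<in> V" using v(3) c by blast
      then have "f v \<notin> f ` F" using v(2) F f by (meson inj_on_image_mem_iff)
      moreover have "insert (f v) (f ` F) = f ` insert v F" by simp
      ultimately show "w \<in> cofacets (f ` F) ((`) f ` c)"
        unfolding cofacets_def v(1) using v(3) by blast
    qed
  qed
  have odd_iff: "f ` F \<in> bd ((`) f ` c) \<longleftrightarrow> F \<in> bd c" if F: "F \<subseteq> V" for F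
  proof -
    have "cofacets F c \<subseteq> V" using c by (auto simp: cofacets_def)
    then have "card (f ` cofacets F c) = card (cofacets F c)"
      using card_image inj_on_subset[OF f] by blast
    then show ?thesis by (simp add: bd_def cof[OF F])
  qed
  show ?thesis
  proof
    show "bd ((`) f ` c) \<subseteq> (`) f ` bd c"
    proof
      fix F' assume F': "F' \<in> bd ((`) f ` c)"
      then obtain w where "insert w F' \<in> (`) f ` c" by (rule bdE)
      then obtain A where A: "insert w F' = f ` A" "A \<in> c" by blast
      define F where "F = {a \<in> A. f a \<in> F'}"
      have "F' = f ` F" using A(1) by (auto simp: F_def)
      moreover have "F \<subseteq> V" using A(2) c by (auto simp: F_def)
      ultimately show "F' \<in> (`) f ` bd c" using F' odd_iff by blast
    qed
    show "(`) f ` bd c \<subseteq> bd ((`) f ` c)"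
    proof
      fix F' assume "F' \<in> (`) f ` bd c"
      then obtain F where F: "F' = f ` F" "F \<in> bd c" by blast
      from F(2) obtain v where "insert v F \<in> c" by (rule bdE)
      then have "F \<subseteq> V" using c by blast
      then show "F' \<in> bd ((`) f ` c)" using F odd_iff by blast
    qed
  qed
qed

lemma lk_image:
  assumes f: "inj_on f V" and c: "c \<subseteq> Pow V" and v: "v \<in> V"
  shows "lk (f v) ((`) f ` c) = (`) f ` lk v c"
proof
  show "lk (f v) ((`) f ` c) \<subseteq> (`) f ` lk v c"
  proof
    fix F' assume "F' \<in> lk (f v) ((`) f ` c)"
    then obtain A where A: "f v \<notin> F'" "insert (f v) F' = f ` A" "A \<in> c" by (auto simp: lk_def)
    have "A \<subseteq> V" using A(3) c by blast
    have "v \<in> A" using inj_on_image_mem_iff[OF f v \<open>A \<subseteq> V\<close>] A(2) by blast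
    have "F' = f ` A - f ` {v}" using A(1,2) by auto
    also have "\<dots> = f ` (A - {v})"
      using inj_on_image_set_diff[OF f, of A "{v}"] \<open>A \<subseteq> V\<close> v by blast
    finally have "F' = f ` (A - {v})" .
    moreover have "A - {v} \<in> lk v c" using A(3) \<open>v \<in> A\<close> by (simp add: lk_def insert_absorb)
    ultimately show "F' \<in> (`) f ` lk v c" by blast
  qed
  show "(`) f ` lk v c \<subseteq> lk (f v) ((`) f ` c)"
  proof
    fix F' assume "F' \<in> (`) f ` lk v c"
    then obtain F where F: "F' = f ` F" "v \<notin> F" "insert v F \<in> c" by (auto simp: lk_def)
    have "F \<subseteq> V" using F(3) c by blast
    then have "f v \<notin> f ` F" using inj_on_image_mem_iff[OF f v] F(2) by blast
    moreover have "insert (f v) (f ` F) = f ` insert v F" by simp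
    ultimately show "F' \<in> lk (f v) ((`) f ` c)" unfolding lk_def F(1) using F(3) by blast
  qed
qed

lemma faces_of_size_image:
  assumes f: "inj_on f V" and c: "c \<subseteq> Pow V"
  shows "faces_of_size n ((`) f ` c) = (`) f ` faces_of_size n c"
proof -
  have "card (f ` F) = card F" if "F \<in> c" for F
    using that c by (intro card_image inj_on_subset[OF f]) blast
  then show ?thesis by auto
qed

lemma simplicial_complex_image:
  assumes "simplicial_complex S"
  shows "simplicial_complex ((`) f ` S)"
proof -
  have "G \<in> (`) f ` S" if G: "F \<in> (`) f ` S" "G \<subseteq> F" for F G
  proof -
    obtain A where A: "F = f ` A" "A \<in> S" using G(1) by blast
    have "{a \<in> A. f a \<in> G} \<in> S" by (rule simplicial_complexD(4)[OF assms A(2)]) blast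
    moreover have "G = f ` {a \<in> A. f a \<in> G}" using G(2) A(1) by auto
    ultimately show ?thesis by blast
  qed
  moreover have "finite ((`) f ` S)" "{} \<in> (`) f ` S"
    using simplicial_complexD(1,2)[OF assms] by (auto intro: rev_image_eqI)
  moreover have "\<forall>F\<in>(`) f ` S. finite F" using simplicial_complexD(3)[OF assms] by blast
  ultimately show ?thesis unfolding simplicial_complex_def by blast
qed

lemma homology_sphere_image:
  assumes "homology_sphere n S" "inj_on f (\<Union>S)"
  shows "homology_sphere n ((`) f ` S)"
  using assms
proof (induction n arbitrary: S)
  case 0
  then show ?case by simp
next
  case (Suc n)
  let ?V = "\<Union>S" and ?\<Phi> = "(`) f"
  have f: "inj_on f ?V" and SV: "S \<subseteq> Pow ?V" using Suc.prems by auto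
  have \<Phi>: "inj_on ?\<Phi> S"
    using inj_on_image_Pow[OF f] SV inj_on_subset by blast
  note cpx = homology_sphere_complex[OF Suc.prems(1)]
  let ?Z = "faces_of_size (Suc n) S"
  have Z: "faces_of_size (Suc n) (?\<Phi> ` S) = ?\<Phi> ` ?Z" by (rule faces_of_size_image[OF f SV])
  have bd_im: "bd (?\<Phi> ` c) = ?\<Phi> ` bd c" if "c \<subseteq> S" for c
    using bd_image[OF f] that SV by blast
  have cycle: "\<exists>e\<subseteq>?\<Phi> ` S. z = bd e \<or> z = sym_diff (bd e) (?\<Phi> ` ?Z)"
    if z: "z \<subseteq> ?\<Phi> ` S" "bd z = {}" for z
  proof -
    obtain y where y: "y \<subseteq> S" "z = ?\<Phi> ` y" using z(1) by (rule subset_imageE)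
    have "bd y = {}" using bd_im[OF y(1)] y(2) z(2) by simp
    then obtain e where e: "e \<subseteq> S" "y = bd e \<or> y = sym_diff (bd e) ?Z"
      using homology_sphere_cycle[OF Suc.prems(1) y(1)] by blast
    have "bd e \<subseteq> S" by (rule bd_subset_complex[OF cpx e(1)])
    then have im: "?\<Phi> ` sym_diff (bd e) ?Z = sym_diff (?\<Phi> ` bd e) (?\<Phi> ` ?Z)"
      using inj_on_image_set_diff[OF \<Phi>, of "bd e" ?Z] inj_on_image_set_diff[OF \<Phi>, of ?Z "bd e"]
      by (simp add: image_Un Diff_subset subset_trans[OF Diff_subset])
    from e(2) have "z = bd (?\<Phi> ` e) \<or> z = sym_diff (bd (?\<Phi> ` e)) (?\<Phi> ` ?Z)"
    proof
      assume "y = bd e"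
      then show ?thesis by (simp only: y(2) bd_im[OF e(1)]) simp
    next
      assume "y = sym_diff (bd e) ?Z"
      then have "z = sym_diff (bd (?\<Phi> ` e)) (?\<Phi> ` ?Z)"
        by (simp only: y(2) im bd_im[OF e(1)])
      then show ?thesis by (rule disjI2)
    qed
    then show ?thesis using e(1) by blast
  qed
  have links: "homology_sphere n (lk w (?\<Phi> ` S))" if w: "{w} \<in> ?\<Phi> ` S" for w
  proof -
    obtain A where A: "{w} = f ` A" "A \<in> S" using w by blast
    then obtain v where v: "v \<in> A" "w = f v" by blast
    have vS: "{v} \<in> S" by (rule simplicial_complexD(4)[OF cpx A(2)]) (use v in simp)
    have "\<Union> (lk v S) \<subseteq> ?V" using lk_subset[OF cpx] by blast
    then have "inj_on f (\<Union> (lk v S))" by (rule inj_on_subset[OF f])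
    moreover have "homology_sphere n (lk v S)" using Suc.prems(1) vS by simp
    ultimately have "homology_sphere n (?\<Phi> ` lk v S)" using Suc.IH by blast
    then show ?thesis using lk_image[OF f SV] vS v(2) by force
  qed
  have dim: "card (f ` F) \<le> Suc n" if "F \<in> S" for F
    using homology_sphere_card_le[OF Suc.prems(1) that]
      card_image_le[OF simplicial_complexD(3)[OF cpx that], of f] by linarith
  have "bd ?Z = {}" using bd_top_faces[OF Suc.prems(1)] .
  then have cyc: "bd (?\<Phi> ` ?Z) = {}" using bd_im[of ?Z] by simp
  have ne: "?\<Phi> ` ?Z \<noteq> {}" using Suc.prems(1) by simp
  show ?case
    unfolding homology_sphere.simps Z
    using simplicial_complex_image[OF cpx, of f] cycle links dim cyc ne
    by (intro conjI allI impI ballI) (auto simp del: homology_sphere.simps)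
qed

section \<open>Recovering the vertices from two adjacent levels\<close>

text \<open>
  The two properties of normal pseudomanifolds that the descent from level to level uses.
\<close>

definition vertices_recoverable :: "nat \<Rightarrow> 'a set set \<Rightarrow> bool" where
  "vertices_recoverable k X \<longleftrightarrow> simplicial_complex X \<and>
     (\<forall>F\<in>X. card F \<le> Suc k \<longrightarrow> (\<exists>F'\<in>X. F \<subseteq> F' \<and> card F' = Suc k)) \<and>
     (\<forall>G\<in>X. 1 \<le> card G \<and> card G \<le> k \<longrightarrow> connected_complex (link G X))"

lemma vertices_recoverableD:
  assumes "vertices_recoverable k X"
  shows "simplicial_complex X"
    and "F \<in> X \<Longrightarrow> card F \<le> Suc k \<Longrightarrow> \<exists>F'\<in>X. F \<subseteq> F' \<and> card F' = Suc k"
    and "G \<in> X \<Longrightarrow> 1 \<le> card G \<Longrightarrow> card G \<le> k \<Longrightarrow> connected_complex (link G X)"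
  using assms by (simp_all add: vertices_recoverable_def)

text \<open>
  An isomorphism between the faces with \<open>j\<close> and \<open>j + 1\<close> vertices that preserves the two levels.  The inverse is
  kept explicit to make the notion visibly symmetric in the two complexes.
\<close>

definition incidence_iso ::
  "nat \<Rightarrow> 'a set set \<Rightarrow> 'b set set \<Rightarrow> ('a set \<Rightarrow> 'b set) \<Rightarrow> ('b set \<Rightarrow> 'a set) \<Rightarrow> bool" where
  "incidence_iso j X Y \<phi> \<psi> \<longleftrightarrow>
     (\<forall>i\<in>{j, Suc j}.
        (\<forall>A\<in>faces_of_size i X. \<phi> A \<in> faces_of_size i Y \<and> \<psi> (\<phi> A) = A) \<and>
        (\<forall>B\<in>faces_of_size i Y. \<psi> B \<in> faces_of_size i X \<and> \<phi> (\<psi> B) = B)) \<and>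
     (\<forall>A\<in>faces_of_size j X. \<forall>F\<in>faces_of_size (Suc j) X. A \<subseteq> F \<longleftrightarrow> \<phi> A \<subseteq> \<phi> F)"

lemma incidence_isoD:
  assumes "incidence_iso j X Y \<phi> \<psi>" "i = j \<or> i = Suc j"
  shows "A \<in> faces_of_size i X \<Longrightarrow> \<phi> A \<in> faces_of_size i Y" "A \<in> faces_of_size i X \<Longrightarrow> \<psi> (\<phi> A) = A"
    "B \<in> faces_of_size i Y \<Longrightarrow> \<psi> B \<in> faces_of_size i X" "B \<in> faces_of_size i Y \<Longrightarrow> \<phi> (\<psi> B) = B"
proof -
  have "(\<forall>A\<in>faces_of_size i X. \<phi> A \<in> faces_of_size i Y \<and> \<psi> (\<phi> A) = A) \<and>
      (\<forall>B\<in>faces_of_size i Y. \<psi> B \<in> faces_of_size i X \<and> \<phi> (\<psi> B) = B)"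
    using assms(1) unfolding incidence_iso_def by (elim conjE) (erule bspec, use assms(2) in simp)
  then have 1: "\<forall>A\<in>faces_of_size i X. \<phi> A \<in> faces_of_size i Y \<and> \<psi> (\<phi> A) = A"
    and 2: "\<forall>B\<in>faces_of_size i Y. \<psi> B \<in> faces_of_size i X \<and> \<phi> (\<psi> B) = B" by (rule conjunct1, rule conjunct2)
  show "A \<in> faces_of_size i X \<Longrightarrow> \<phi> A \<in> faces_of_size i Y" "A \<in> faces_of_size i X \<Longrightarrow> \<psi> (\<phi> A) = A"
    by (drule bspec[OF 1], erule conjE, assumption)+
  show "B \<in> faces_of_size i Y \<Longrightarrow> \<psi> B \<in> faces_of_size i X" "B \<in> faces_of_size i Y \<Longrightarrow> \<phi> (\<psi> B) = B"
    by (drule bspec[OF 2], erule conjE, assumption)+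
qed

lemma incidence_iso_subset:
  assumes "incidence_iso j X Y \<phi> \<psi>" "A \<in> faces_of_size j X" "F \<in> faces_of_size (Suc j) X"
  shows "A \<subseteq> F \<longleftrightarrow> \<phi> A \<subseteq> \<phi> F"
proof -
  have "\<forall>A\<in>faces_of_size j X. \<forall>F\<in>faces_of_size (Suc j) X. A \<subseteq> F \<longleftrightarrow> \<phi> A \<subseteq> \<phi> F"
    using assms(1) unfolding incidence_iso_def by (rule conjunct2)
  from bspec[OF bspec[OF this assms(2)] assms(3)] show ?thesis .
qed

lemma incidence_iso_sym:
  assumes "incidence_iso j X Y \<phi> \<psi>"
  shows "incidence_iso j Y X \<psi> \<phi>"
proof -
  have sub: "B \<subseteq> F \<longleftrightarrow> \<psi> B \<subseteq> \<psi> F" if B: "B \<in> faces_of_size j Y" and F: "F \<in> faces_of_size (Suc j) Y" for B F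
    using incidence_iso_subset[OF assms incidence_isoD(3)[OF assms disjI1[OF refl] B]
        incidence_isoD(3)[OF assms disjI2[OF refl] F]]
      incidence_isoD(4)[OF assms disjI1[OF refl] B] incidence_isoD(4)[OF assms disjI2[OF refl] F]
    by simp
  show ?thesis
    unfolding incidence_iso_def
  proof (intro conjI ballI)
    fix i assume "i \<in> {j, Suc j}"
    then have i: "i = j \<or> i = Suc j" by simp
    show "\<psi> B \<in> faces_of_size i X" "\<phi> (\<psi> B) = B" if "B \<in> faces_of_size i Y" for B
      using incidence_isoD(3,4)[OF assms i that] by this+
    show "\<phi> A \<in> faces_of_size i Y" "\<psi> (\<phi> A) = A" if "A \<in> faces_of_size i X" for A
      using incidence_isoD(1,2)[OF assms i that] by this+
  qed (rule sub)
qed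

lemma card_inter_of_facets:
  assumes "card F = Suc j" "card A = j" "card B = j" "A \<subseteq> F" "B \<subseteq> F" "A \<noteq> B"
  shows "Suc (card (A \<inter> B)) = j" "A \<union> B = F"
proof -
  have fF: "finite F" using assms(1) by (intro card_ge_0_finite) simp
  have fA: "finite A" "finite B"
    by (rule finite_subset[OF assms(4) fF], rule finite_subset[OF assms(5) fF])
  have "\<not> B \<subseteq> A" using card_subset_eq[OF fA(1), of B] assms by auto
  then have "A \<subset> A \<union> B" by blast
  then have "j < card (A \<union> B)" using psubset_card_mono[of "A \<union> B" A] fA assms(2) by simp
  moreover have "card (A \<union> B) \<le> Suc j" using card_mono[OF fF, of "A \<union> B"] assms by simp
  ultimately have c: "card (A \<union> B) = Suc j" by simp
  then show "A \<union> B = F" using card_subset_eq[OF fF, of "A \<union> B"] assms by simp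
  show "Suc (card (A \<inter> B)) = j" using card_Un_Int[OF fA] c assms(2,3) by simp
qed

text \<open>
  Sets of size \<open>j\<close> that pairwise meet in \<open>j - 1\<close> elements either share these elements or all lie in one
  set of size \<open>j + 1\<close>; the latter is excluded by \<open>F \<noteq> F'\<close>.
\<close>

lemma triangle_common_intersection:
  assumes card: "card A = j" "card B = j" "card C = j"
      "card F = Suc j" "card F' = Suc j" "card H = Suc j"
    and sub: "A \<subseteq> F" "B \<subseteq> F" "A \<subseteq> F'" "C \<subseteq> F'" "B \<subseteq> H" "C \<subseteq> H"
    and ne: "A \<noteq> B" "A \<noteq> C" "B \<noteq> C" "F \<noteq> F'"
  shows "A \<inter> B = A \<inter> C"
proof -
  note AB = card_inter_of_facets[OF card(4,1,2) sub(1,2) ne(1)]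
  note AC = card_inter_of_facets[OF card(5,1,3) sub(3,4) ne(2)]
  note BC = card_inter_of_facets[OF card(6,2,3) sub(5,6) ne(3)]
  have fin: "finite F" "finite F'" using card by (auto intro: card_ge_0_finite)
  have fA: "finite A" by (rule finite_subset[OF sub(1) fin(1)])
  have "card (F - A) = 1" using card_Diff_subset[OF fA sub(1)] card by simp
  then obtain p where p: "F - A = {p}" by (rule card_1_singletonE)
  have "card (F' - A) = 1" using card_Diff_subset[OF fA sub(3)] card by simp
  then obtain q where q: "F' - A = {q}" by (rule card_1_singletonE)
  have F_eq: "F = insert p A" using p sub(1) by blast
  have F'_eq: "F' = insert q A" using q sub(3) by blast
  have "p \<noteq> q" using F_eq F'_eq ne(4) by blast
  moreover have "B \<subseteq> insert p A" "C \<subseteq> insert q A" using sub(2,4) F_eq F'_eq by simp_all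
  ultimately have BC_A: "B \<inter> C \<subseteq> A" by blast
  have "B \<inter> C \<subseteq> A \<inter> B" using BC_A by blast
  then have 1: "B \<inter> C = A \<inter> B" using AB(1) BC(1) card_subset_eq[of "A \<inter> B" "B \<inter> C"] fA by simp
  have "B \<inter> C \<subseteq> A \<inter> C" using BC_A by blast
  then have 2: "B \<inter> C = A \<inter> C" using AC(1) BC(1) card_subset_eq[of "A \<inter> C" "B \<inter> C"] fA by simp
  from 1[symmetric] 2 show ?thesis by (rule trans)
qed

lemma insert_mem_of_edge:
  assumes "{u, w} \<in> link A X"
  shows "u \<notin> A" "w \<notin> A" "insert u (insert w A) \<in> X"
proof -
  have "{u, w} \<inter> A = {}" "{u, w} \<union> A \<in> X" using assms by (simp_all only: mem_link_iff)
  then show "u \<notin> A" "w \<notin> A" "insert u (insert w A) \<in> X" by auto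
qed

text \<open>
  For an edge \<open>{x, y}\<close> of the link of \<open>A\<close>, the faces \<open>A\<close>, \<open>A - {a} \<union> {x}\<close> and \<open>A - {a} \<union> {y}\<close> form a
  triangle to which \<open>triangle_common_intersection\<close> applies after mapping.  A path in the link of \<open>A\<close> joins \<open>u\<close> to \<open>w\<close>.
\<close>

lemma intersection_along_link:
  assumes X: "vertices_recoverable k X" and \<phi>: "incidence_iso j X Y \<phi> \<psi>"
    and j: "1 \<le> j" "j \<le> k" and A: "A \<in> faces_of_size j X" "a \<in> A"
    and uw: "u \<in> \<Union> (link A X)" "w \<in> \<Union> (link A X)"
  shows "\<phi> A \<inter> \<phi> (insert u (A - {a})) = \<phi> A \<inter> \<phi> (insert w (A - {a}))"
proof -
  note cpx = vertices_recoverableD(1)[OF X]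
  have A': "A \<in> X" "card A = j" using A(1) by auto
  have finA: "finite A" by (rule simplicial_complexD(3)[OF cpx A'(1)])
  have cAa: "Suc (card (A - {a})) = j" using card_Suc_Diff1[OF finA A(2)] A'(2) by simp
  have step: "\<phi> A \<inter> \<phi> (insert x (A - {a})) = \<phi> A \<inter> \<phi> (insert y (A - {a}))"
    if e: "{x, y} \<in> link A X" for x y
  proof (cases "x = y")
    case False
    let ?B = "insert x (A - {a})" and ?C = "insert y (A - {a})"
    let ?F = "insert x A" and ?F' = "insert y A" and ?H = "insert x (insert y (A - {a}))"
    note xy = insert_mem_of_edge[OF e]
    have faces: "?B \<in> X" "?C \<in> X" "?F \<in> X" "?F' \<in> X" "?H \<in> X"
      by (rule simplicial_complexD(4)[OF cpx xy(3)]; blast)+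
    have t: "?B \<in> faces_of_size j X" "?C \<in> faces_of_size j X" "?F \<in> faces_of_size (Suc j) X"
        "?F' \<in> faces_of_size (Suc j) X" "?H \<in> faces_of_size (Suc j) X"
      using faces xy False finA cAa A'(2) by simp_all
    have "?B \<noteq> ?C" "?F \<noteq> ?F'" "A \<noteq> ?B" "A \<noteq> ?C" using xy False by auto
    then have ne: "\<phi> A \<noteq> \<phi> ?B" "\<phi> A \<noteq> \<phi> ?C" "\<phi> ?B \<noteq> \<phi> ?C" "\<phi> ?F \<noteq> \<phi> ?F'"
      using incidence_isoD(2)[OF \<phi>] A(1) t by metis+
    note im = incidence_isoD(1)[OF \<phi> disjI1[OF refl] A(1)]
      incidence_isoD(1)[OF \<phi> disjI1[OF refl] t(1)] incidence_isoD(1)[OF \<phi> disjI1[OF refl] t(2)]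
      incidence_isoD(1)[OF \<phi> disjI2[OF refl] t(3)] incidence_isoD(1)[OF \<phi> disjI2[OF refl] t(4)]
      incidence_isoD(1)[OF \<phi> disjI2[OF refl] t(5)]
    note sub = incidence_iso_subset[OF \<phi>]
    show ?thesis
    proof (rule triangle_common_intersection)
      show "card (\<phi> A) = j" "card (\<phi> ?B) = j" "card (\<phi> ?C) = j"
        "card (\<phi> ?F) = Suc j" "card (\<phi> ?F') = Suc j" "card (\<phi> ?H) = Suc j"
        using im by simp_all
      show "\<phi> A \<subseteq> \<phi> ?F" using sub[OF A(1) t(3)] by blast
      show "\<phi> A \<subseteq> \<phi> ?F'" using sub[OF A(1) t(4)] by blast
      show "\<phi> ?B \<subseteq> \<phi> ?F" using sub[OF t(1,3)] by blast
      show "\<phi> ?C \<subseteq> \<phi> ?F'" using sub[OF t(2,4)] by blast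
      show "\<phi> ?B \<subseteq> \<phi> ?H" using sub[OF t(1,5)] by blast
      show "\<phi> ?C \<subseteq> \<phi> ?H" using sub[OF t(2,5)] by blast
    qed (rule ne)+
  qed simp
  have "connected_complex (link A X)"
    using vertices_recoverableD(3)[OF X A'(1)] A'(2) j by simp
  then have "(u, w) \<in> {(x, y). {x, y} \<in> link A X}\<^sup>*"
    using uw unfolding connected_complex_def by blast
  then show ?thesis
  proof (induction rule: rtrancl_induct)
    case (step y z)
    then show ?case using step.IH \<open>\<And>y x. {x, y} \<in> link A X \<Longrightarrow> _\<close>[of y z] by simp
  qed simp
qed

lemma next_vertex:
  assumes X: "vertices_recoverable k X" and G: "G \<in> X" "card G \<le> k"
  obtains w where "w \<notin> G" "insert w G \<in> X"
proof -
  have "card G \<le> Suc k" using G(2) by simp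
  then obtain F where F: "F \<in> X" "G \<subseteq> F" "card F = Suc k"
    using vertices_recoverableD(2)[OF X G(1)] by blast
  have "G \<noteq> F" using F(3) G(2) by auto
  then obtain w where w: "w \<in> F" "w \<notin> G" using F(2) by blast
  have "insert w G \<in> X"
    by (rule simplicial_complexD(4)[OF vertices_recoverableD(1)[OF X] F(1)]) (use w F(2) in blast)
  then show ?thesis by (rule that[OF w(2)])
qed

text \<open>
  The intersections are indexed by the edges of the link of \<open>G\<close>.  Edges with a common end point
  \<open>x\<close> give the same intersection, by \<open>intersection_along_link\<close> for the face \<open>insert x G\<close>; connectedness of the link of \<open>G\<close> does the rest.
\<close>

lemma intersection_depends_on_face:
  assumes X: "vertices_recoverable k X" and \<phi>: "incidence_iso j X Y \<phi> \<psi>"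
    and j: "2 \<le> j" "j \<le> k" and G: "G \<in> X" "Suc (card G) = j"
    and uw: "{u, w} \<in> link G X" "u \<noteq> w" and uw': "{u', w'} \<in> link G X" "u' \<noteq> w'"
  shows "\<phi> (insert u G) \<inter> \<phi> (insert w G) = \<phi> (insert u' G) \<inter> \<phi> (insert w' G)"
proof -
  note cpx = vertices_recoverableD(1)[OF X]
  have finG: "finite G" by (rule simplicial_complexD(3)[OF cpx G(1)])
  let ?P = "\<lambda>x y. \<phi> (insert x G) \<inter> \<phi> (insert y G)"
  have same_start: "?P x y = ?P x z"
    if xy: "{x, y} \<in> link G X" "x \<noteq> y" and xz: "{x, z} \<in> link G X" "x \<noteq> z" for x y z
  proof -
    note m = insert_mem_of_edge[OF xy(1)] insert_mem_of_edge[OF xz(1)]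
    have xG: "insert x G \<in> X" by (rule simplicial_complexD(4)[OF cpx m(3)]) blast
    have "insert x G \<in> faces_of_size j X" using xG m(1) finG G(2) by simp
    moreover have "{y} \<in> link (insert x G) X" "{z} \<in> link (insert x G) X"
      using m xy(2) xz(2) by (simp_all add: mem_link_iff insert_commute)
    then have "y \<in> \<Union> (link (insert x G) X)" "z \<in> \<Union> (link (insert x G) X)" by blast+
    ultimately have "\<phi> (insert x G) \<inter> \<phi> (insert y (insert x G - {x})) =
        \<phi> (insert x G) \<inter> \<phi> (insert z (insert x G - {x}))"
      using j by (intro intersection_along_link[OF X \<phi>]) simp_all
    then show ?thesis using m(1) by simp
  qed
  have "connected_complex (link G X)"
    using vertices_recoverableD(3)[OF X G(1)] G(2) j by simp
  then have "(u, u') \<in> {(x, y). {x, y} \<in> link G X}\<^sup>*"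
    using uw(1) uw'(1) unfolding connected_complex_def by blast
  then have "\<forall>y. {u', y} \<in> link G X \<and> u' \<noteq> y \<longrightarrow> ?P u' y = ?P u w"
  proof (induction rule: rtrancl_induct)
    case base
    then show ?case using same_start uw by blast
  next
    case (step y z)
    have yz: "{y, z} \<in> link G X" using step.hyps(2) by simp
    show ?case
    proof (cases "y = z")
      case True
      then show ?thesis using step.IH by simp
    next
      case False
      have zy: "{z, y} \<in> link G X" using yz by (simp only: insert_commute)
      have "?P z x = ?P u w" if "{z, x} \<in> link G X" "z \<noteq> x" for x
      proof -
        have "?P z x = ?P z y" using same_start[OF that zy] False by simp
        also have "\<dots> = ?P y z" by (rule Int_commute)
        also have "\<dots> = ?P u w" using step.IH yz False by blast
        finally show ?thesis .
      qed
      then show ?thesis by blast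
    qed
  qed
  then show ?thesis using uw' by simp
qed

text \<open>
  The image of a face one level down is forced to be contained in the images of all faces above it.  Their
  intersection is the choice-free candidate; \<open>descend_eq\<close> shows that two adjacent faces
  already cut it out.  Faces of size \<open>j\<close> keep their image, so that one function serves both levels.
\<close>

definition descend :: "nat \<Rightarrow> 'a set set \<Rightarrow> ('a set \<Rightarrow> 'b set) \<Rightarrow> 'a set \<Rightarrow> 'b set" where
  "descend j X \<phi> G = (if card G = j then \<phi> G else \<Inter> (\<phi> ` {A \<in> faces_of_size j X. G \<subseteq> A}))"

lemma facet_pair:
  assumes X: "vertices_recoverable k X" and j: "j \<le> k"
    and G: "Suc (card G) = j" and A: "A \<in> faces_of_size j X" "G \<subseteq> A"
  obtains B F where "B \<in> faces_of_size j X" "F \<in> faces_of_size (Suc j) X" "A \<noteq> B" "A \<subseteq> F" "B \<subseteq> F" "A \<inter> B = G"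
proof -
  note cpx = vertices_recoverableD(1)[OF X]
  have AX: "A \<in> X" "card A = j" using A(1) by auto
  have finA: "finite A" by (rule simplicial_complexD(3)[OF cpx AX(1)])
  have finG: "finite G" by (rule finite_subset[OF A(2) finA])
  have "card A \<le> k" using AX(2) j by simp
  with X AX(1) obtain w where w: "w \<notin> A" "insert w A \<in> X" by (rule next_vertex)
  have "insert w G \<in> X" by (rule simplicial_complexD(4)[OF cpx w(2)]) (use A(2) in blast)
  moreover have "w \<notin> G" using w(1) A(2) by blast
  ultimately have B: "insert w G \<in> faces_of_size j X" using G finG by simp
  have F: "insert w A \<in> faces_of_size (Suc j) X" using w AX(2) finA by simp
  have "A \<noteq> insert w G" "A \<subseteq> insert w A" "insert w G \<subseteq> insert w A" "A \<inter> insert w G = G"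
    using w(1) A(2) by auto
  then show ?thesis by (rule that[OF B F])
qed

text \<open>
  Every adjacent pair of faces meeting in \<open>G\<close> has the same intersection of images, and every face of
  size \<open>j\<close> above \<open>G\<close> belongs to such a pair; so that intersection lies in all the sets whose intersection
  defines the image of \<open>G\<close>.
\<close>

lemma descend_eq:
  assumes X: "vertices_recoverable k X" and \<phi>: "incidence_iso j X Y \<phi> \<psi>"
    and j: "2 \<le> j" "j \<le> k"
    and A: "A \<in> faces_of_size j X" and B: "B \<in> faces_of_size j X" and ne: "A \<noteq> B"
    and F: "F \<in> faces_of_size (Suc j) X" "A \<subseteq> F" "B \<subseteq> F"
  shows "descend j X \<phi> (A \<inter> B) = \<phi> A \<inter> \<phi> B"
proof -
  note cpx = vertices_recoverableD(1)[OF X]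
  let ?G = "A \<inter> B"
  have G: "Suc (card ?G) = j" "A \<union> B = F"
    using card_inter_of_facets[of F j A B] A B F ne by auto
  have GX: "?G \<in> X" by (rule simplicial_complexD(4)[OF cpx, of A]) (use A in auto)
  have pair_edge: "\<exists>u w. u \<noteq> w \<and> {u, w} \<in> link ?G X \<and> insert u ?G = C \<and> insert w ?G = D"
    if C: "C \<in> faces_of_size j X" and D: "D \<in> faces_of_size j X" and CD: "C \<noteq> D" "C \<inter> D = ?G"
      and E: "E \<in> faces_of_size (Suc j) X" "C \<subseteq> E" "D \<subseteq> E" for C D E
  proof -
    have fin: "finite C" "finite D" using C D simplicial_complexD(3)[OF cpx] by auto
    have sub: "?G \<subseteq> C" "?G \<subseteq> D" using CD(2) by auto
    have finG: "finite ?G" by (rule finite_subset[OF sub(1) fin(1)])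
    have "card (C - ?G) = 1" using card_Diff_subset[OF finG sub(1)] C G(1) by auto
    then obtain u where u: "C - ?G = {u}" by (rule card_1_singletonE)
    have "card (D - ?G) = 1" using card_Diff_subset[OF finG sub(2)] D G(1) by auto
    then obtain w where w: "D - ?G = {w}" by (rule card_1_singletonE)
    have C_eq: "insert u ?G = C" using u sub(1) by blast
    have D_eq: "insert w ?G = D" using w sub(2) by blast
    have "{u, w} \<inter> ?G = {}" using u w by blast
    moreover have "{u, w} \<union> ?G \<in> X"
      by (rule simplicial_complexD(4)[OF cpx, of E]) (use E C_eq D_eq in auto)
    ultimately have "{u, w} \<in> link ?G X" by (simp only: mem_link_iff)
    moreover have "u \<noteq> w" using C_eq D_eq CD(1) by blast
    ultimately show ?thesis using C_eq D_eq by blast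
  qed
  have same: "\<phi> C \<inter> \<phi> D = \<phi> A \<inter> \<phi> B"
    if C: "C \<in> faces_of_size j X" and D: "D \<in> faces_of_size j X" and CD: "C \<noteq> D" "C \<inter> D = ?G"
      and E: "E \<in> faces_of_size (Suc j) X" "C \<subseteq> E" "D \<subseteq> E" for C D E
  proof -
    obtain u w where uw: "u \<noteq> w" "{u, w} \<in> link ?G X" "insert u ?G = C" "insert w ?G = D"
      using pair_edge[OF C D CD E] by blast
    obtain x y where xy: "x \<noteq> y" "{x, y} \<in> link ?G X" "insert x ?G = A" "insert y ?G = B"
      using pair_edge[OF A B ne refl F] by blast
    show ?thesis
      using intersection_depends_on_face[OF X \<phi> j GX G(1) uw(2,1) xy(2,1)] uw(3,4) xy(3,4) by simp
  qed
  have "\<phi> A \<inter> \<phi> B \<subseteq> \<phi> C" if C: "C \<in> faces_of_size j X" "?G \<subseteq> C" for C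
  proof -
    obtain D E where "D \<in> faces_of_size j X" "E \<in> faces_of_size (Suc j) X" "C \<noteq> D" "C \<subseteq> E" "D \<subseteq> E" "C \<inter> D = ?G"
      by (rule facet_pair[OF X j(2) G(1) C])
    then have "\<phi> C \<inter> \<phi> D = \<phi> A \<inter> \<phi> B" by (intro same[OF C(1)])
    then show ?thesis by blast
  qed
  then have "\<phi> A \<inter> \<phi> B \<subseteq> \<Inter> (\<phi> ` {C \<in> faces_of_size j X. ?G \<subseteq> C})" by blast
  moreover have "\<Inter> (\<phi> ` {C \<in> faces_of_size j X. ?G \<subseteq> C}) \<subseteq> \<phi> A \<inter> \<phi> B"
    using A B by (intro Int_greatest INF_lower) auto
  ultimately have "\<Inter> (\<phi> ` {C \<in> faces_of_size j X. ?G \<subseteq> C}) = \<phi> A \<inter> \<phi> B" by (rule equalityI[rotated])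
  moreover have "card ?G \<noteq> j" using G(1) by simp
  ultimately show ?thesis by (simp only: descend_def if_False)
qed

lemma descend_same: "A \<in> faces_of_size j X \<Longrightarrow> descend j X \<phi> A = \<phi> A"
  by (simp add: descend_def)

lemma descend_subset:
  assumes "G \<in> faces_of_size i X" "A \<in> faces_of_size (Suc i) X" "G \<subseteq> A"
  shows "descend (Suc i) X \<phi> G \<subseteq> \<phi> A"
proof -
  have "card G \<noteq> Suc i" using assms(1) by simp
  moreover have "\<Inter> (\<phi> ` {C \<in> faces_of_size (Suc i) X. G \<subseteq> C}) \<subseteq> \<phi> A"
    by (rule INF_lower) (use assms in simp)
  ultimately show ?thesis by (simp only: descend_def if_False)
qed

text \<open>
  Write \<open>G\<close> as the intersection of adjacent faces \<open>A\<close> and \<open>B\<close>.  Their images are adjacent, meet in the image of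
  \<open>G\<close>, and are carried back to \<open>A\<close> and \<open>B\<close>.
\<close>

lemma descend_inverse:
  assumes X: "vertices_recoverable k X" and Y: "vertices_recoverable k Y"
    and \<phi>: "incidence_iso (Suc i) X Y \<phi> \<psi>" and i: "1 \<le> i" "Suc i \<le> k"
    and G: "G \<in> faces_of_size i X"
  shows "descend (Suc i) X \<phi> G \<in> faces_of_size i Y"
    and "descend (Suc i) Y \<psi> (descend (Suc i) X \<phi> G) = G"
proof -
  let ?j = "Suc i"
  have G': "G \<in> X" "card G = i" using G by auto
  have j: "2 \<le> ?j" "?j \<le> k" using i by auto
  have finG: "finite G" by (rule simplicial_complexD(3)[OF vertices_recoverableD(1)[OF X] G'(1)])
  have "card G \<le> k" using G'(2) i by simp
  with X G'(1) obtain w where w: "w \<notin> G" "insert w G \<in> X" by (rule next_vertex)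
  have A: "insert w G \<in> faces_of_size ?j X" using w finG G'(2) by simp
  have "Suc (card G) = ?j" using G'(2) by simp
  from facet_pair[OF X j(2) this A subset_insertI]
  obtain B F where BF: "B \<in> faces_of_size ?j X" "F \<in> faces_of_size (Suc ?j) X" "insert w G \<noteq> B"
    "insert w G \<subseteq> F" "B \<subseteq> F" "insert w G \<inter> B = G" .
  let ?A = "insert w G"
  have eq: "descend ?j X \<phi> G = \<phi> ?A \<inter> \<phi> B"
    using descend_eq[OF X \<phi> j A BF(1,3,2,4,5)] BF(6) by simp
  note imA = incidence_isoD(1)[OF \<phi> disjI1[OF refl] A]
    and imB = incidence_isoD(1)[OF \<phi> disjI1[OF refl] BF(1)]
    and imF = incidence_isoD(1)[OF \<phi> disjI2[OF refl] BF(2)]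
  have inv: "\<psi> (\<phi> ?A) = ?A" "\<psi> (\<phi> B) = B"
    using incidence_isoD(2)[OF \<phi> disjI1[OF refl]] A BF(1) by blast+
  have ne: "\<phi> ?A \<noteq> \<phi> B" using inv BF(3) by metis
  have sub: "\<phi> ?A \<subseteq> \<phi> F" "\<phi> B \<subseteq> \<phi> F"
    using incidence_iso_subset[OF \<phi> A BF(2)] incidence_iso_subset[OF \<phi> BF(1,2)] BF(4,5) by simp_all
  have "Suc (card (\<phi> ?A \<inter> \<phi> B)) = ?j"
    by (rule card_inter_of_facets(1)[of "\<phi> F"]) (use imA imB imF sub ne in simp_all)
  moreover have "\<phi> ?A \<inter> \<phi> B \<in> Y"
    by (rule simplicial_complexD(4)[OF vertices_recoverableD(1)[OF Y], of "\<phi> B"]) (use imB in auto)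
  ultimately show "descend ?j X \<phi> G \<in> faces_of_size i Y" unfolding eq by simp
  have "descend ?j Y \<psi> (\<phi> ?A \<inter> \<phi> B) = \<psi> (\<phi> ?A) \<inter> \<psi> (\<phi> B)"
    by (rule descend_eq[OF Y incidence_iso_sym[OF \<phi>] j imA imB ne imF sub])
  also have "\<dots> = G" using inv BF(6) by simp
  finally show "descend ?j Y \<psi> (descend ?j X \<phi> G) = G" unfolding eq .
qed

lemma incidence_iso_descend:
  assumes X: "vertices_recoverable k X" and Y: "vertices_recoverable k Y"
    and \<phi>: "incidence_iso (Suc i) X Y \<phi> \<psi>" and i: "1 \<le> i" "Suc i \<le> k"
  shows "incidence_iso i X Y (descend (Suc i) X \<phi>) (descend (Suc i) Y \<psi>)"
proof -
  let ?g = "descend (Suc i) X \<phi>" and ?h = "descend (Suc i) Y \<psi>"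
  note \<psi> = incidence_iso_sym[OF \<phi>]
  note XY = descend_inverse[OF X Y \<phi> i] and YX = descend_inverse[OF Y X \<psi> i]
  note top = incidence_isoD[OF \<phi> disjI1[OF refl]]
  have XY': "?g A \<in> faces_of_size (Suc i) Y" "?h (?g A) = A" if "A \<in> faces_of_size (Suc i) X" for A
    using top(1,2)[OF that] descend_same[OF that, of \<phi>] descend_same[OF top(1)[OF that], of \<psi>]
    by simp_all
  have YX': "?h B \<in> faces_of_size (Suc i) X" "?g (?h B) = B" if "B \<in> faces_of_size (Suc i) Y" for B
    using top(3,4)[OF that] descend_same[OF that, of \<psi>] descend_same[OF top(3)[OF that], of \<phi>]
    by simp_all
  have sub: "G \<subseteq> A \<longleftrightarrow> ?g G \<subseteq> ?g A" if G: "G \<in> faces_of_size i X" and A: "A \<in> faces_of_size (Suc i) X" for G A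
  proof
    assume "G \<subseteq> A"
    then show "?g G \<subseteq> ?g A"
      using descend_subset[OF G A, of \<phi>] descend_same[OF A, of \<phi>] by simp
  next
    assume "?g G \<subseteq> ?g A"
    then have "?h (?g G) \<subseteq> \<psi> (?g A)" by (rule descend_subset[OF XY(1)[OF G] XY'(1)[OF A]])
    then show "G \<subseteq> A" using XY(2)[OF G] top(2)[OF A] descend_same[OF A, of \<phi>] by simp
  qed
  show ?thesis
    unfolding incidence_iso_def
  proof (intro conjI ballI)
    fix l assume "l \<in> {i, Suc i}"
    then consider "l = i" | "l = Suc i" by blast
    note l = this
    show "?g A \<in> faces_of_size l Y" if "A \<in> faces_of_size l X" for A
      using l by cases (use XY(1) XY'(1) that in blast)+
    show "?h (?g A) = A" if "A \<in> faces_of_size l X" for A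
      using l by cases (use XY(2) XY'(2) that in blast)+
    show "?h B \<in> faces_of_size l X" if "B \<in> faces_of_size l Y" for B
      using l by cases (use YX(1) YX'(1) that in blast)+
    show "?g (?h B) = B" if "B \<in> faces_of_size l Y" for B
      using l by cases (use YX(2) YX'(2) that in blast)+
  qed (rule sub)
qed

text \<open>
  A face with at least two vertices is the union of its facets.
\<close>

lemma vertex_map_extends:
  assumes X: "simplicial_complex X" and \<phi>: "incidence_iso j X Y \<phi> \<psi>" and j: "1 \<le> j"
    and f: "inj_on f (\<Union>X)" "\<And>A. A \<in> faces_of_size j X \<Longrightarrow> \<phi> A = f ` A"
    and F: "F \<in> faces_of_size (Suc j) X"
  shows "\<phi> F = f ` F"
proof -
  have F': "F \<in> X" "card F = Suc j" using F by auto
  have finF: "finite F" by (rule simplicial_complexD(3)[OF X F'(1)])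
  have im: "card (\<phi> F) = Suc j" using incidence_isoD(1)[OF \<phi> disjI2[OF refl] F] by simp
  have "f ` F \<subseteq> \<phi> F"
  proof
    fix y assume "y \<in> f ` F"
    then obtain v where v: "y = f v" "v \<in> F" by blast
    have "card (F - {v}) \<noteq> 0" using v(2) finF F'(2) j by simp
    then have "F - {v} \<noteq> {}" by (metis card.empty)
    then obtain u where u: "u \<in> F" "u \<noteq> v" by blast
    have "F - {u} \<in> X" by (rule simplicial_complexD(4)[OF X F'(1)]) blast
    then have A: "F - {u} \<in> faces_of_size j X" using finF F'(2) u(1) by simp
    have "\<phi> (F - {u}) \<subseteq> \<phi> F" using incidence_iso_subset[OF \<phi> A F] by blast
    moreover have "f v \<in> \<phi> (F - {u})" unfolding f(2)[OF A] using v(2) u(2) by blast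
    ultimately show "y \<in> \<phi> F" using v(1) by blast
  qed
  moreover have "card (f ` F) = card F"
    by (rule card_image[OF inj_on_subset[OF f(1)]]) (use F'(1) in blast)
  moreover have "finite (\<phi> F)" using im by (intro card_ge_0_finite) simp
  ultimately show ?thesis using card_subset_eq[of "\<phi> F" "f ` F"] im F'(2) by simp
qed

text \<open>
  The isomorphism descends to vertices and edges, where the vertex map can be read off.  On the way
  back up, faces of size \<open>j\<close> determine the faces of size \<open>j + 1\<close>.
\<close>

lemma vertex_map_exists:
  assumes X: "vertices_recoverable k X" and Y: "vertices_recoverable k Y"
  shows "\<lbrakk>1 \<le> j; j \<le> k; incidence_iso j X Y \<phi> \<psi>\<rbrakk> \<Longrightarrow>
    \<exists>f. inj_on f (\<Union>X) \<and> (\<forall>F. F \<in> faces_of_size j X \<or> F \<in> faces_of_size (Suc j) X \<longrightarrow> \<phi> F = f ` F)"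
proof (induction j arbitrary: \<phi> \<psi> rule: dec_induct)
  case base
  note cpx = vertices_recoverableD(1)[OF X] and \<phi> = base.prems(2)
  define f where "f v = the_elem (\<phi> {v})" for v
  have sing: "{v} \<in> faces_of_size 1 X" if v: "v \<in> \<Union>X" for v
  proof -
    obtain F where F: "F \<in> X" "v \<in> F" using v by blast
    have "{v} \<in> X" by (rule simplicial_complexD(4)[OF cpx F(1)]) (use F(2) in simp)
    then show ?thesis by simp
  qed
  have f: "\<phi> {v} = {f v}" if v: "v \<in> \<Union>X" for v
  proof -
    have "card (\<phi> {v}) = 1" using incidence_isoD(1)[OF \<phi> disjI1[OF refl] sing[OF v]] by simp
    then obtain y where "\<phi> {v} = {y}" by (rule card_1_singletonE)
    then show ?thesis by (simp add: f_def)
  qed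
  have inj: "inj_on f (\<Union>X)"
  proof (rule inj_onI)
    fix u v assume uv: "u \<in> \<Union>X" "v \<in> \<Union>X" "f u = f v"
    have "\<phi> {u} = \<phi> {v}" using f[OF uv(1)] f[OF uv(2)] uv(3) by simp
    then have "\<psi> (\<phi> {u}) = \<psi> (\<phi> {v})" by simp
    then have "{u} = {v}"
      using incidence_isoD(2)[OF \<phi> disjI1[OF refl] sing[OF uv(1)]]
        incidence_isoD(2)[OF \<phi> disjI1[OF refl] sing[OF uv(2)]] by simp
    then show "u = v" by simp
  qed
  have low: "\<phi> A = f ` A" if A: "A \<in> faces_of_size 1 X" for A
  proof -
    have A': "A \<in> X" "card A = 1" using A by auto
    obtain v where v: "A = {v}" using A'(2) by (rule card_1_singletonE)
    have "v \<in> \<Union>X" using A'(1) v by blast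
    then show ?thesis using f v by simp
  qed
  have high: "\<phi> F = f ` F" if "F \<in> faces_of_size (Suc 1) X" for F
    using vertex_map_extends[OF cpx \<phi> le_refl inj low that] .
  show ?case
    by (intro exI[of _ f] conjI allI impI inj) (erule disjE, erule low, erule high)
next
  case (step i)
  note \<phi> = step.prems(2)
  have "incidence_iso i X Y (descend (Suc i) X \<phi>) (descend (Suc i) Y \<psi>)"
    using incidence_iso_descend[OF X Y \<phi>] step.hyps(1) step.prems(1) by simp
  from step.IH[OF Suc_leD[OF step.prems(1)] this]
  obtain f where f: "inj_on f (\<Union>X)"
    "\<forall>F. F \<in> faces_of_size i X \<or> F \<in> faces_of_size (Suc i) X \<longrightarrow> descend (Suc i) X \<phi> F = f ` F"
    by (elim exE conjE)
  have low: "\<phi> A = f ` A" if "A \<in> faces_of_size (Suc i) X" for A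
    using mp[OF spec[OF f(2)] disjI2[OF that]] descend_same[OF that, of \<phi>] by simp
  have high: "\<phi> F = f ` F" if "F \<in> faces_of_size (Suc (Suc i)) X" for F
    by (rule vertex_map_extends[OF vertices_recoverableD(1)[OF X] \<phi> _ f(1) low that]) simp
  show ?case
    by (intro exI[of _ f] conjI allI impI f(1)) (erule disjE, erule low, erule high)
qed

lemma vertex_map_skeleton:
  assumes X: "vertices_recoverable k X" and Y: "vertices_recoverable k Y"
    and \<phi>: "incidence_iso k X Y \<phi> \<psi>"
    and f: "\<And>F. F \<in> faces_of_size (Suc k) X \<Longrightarrow> \<phi> F = f ` F"
  shows "(`) f ` {F \<in> X. card F \<le> Suc k} = {F \<in> Y. card F \<le> Suc k}"
proof
  note cpx = vertices_recoverableD(1)[OF X] and cpy = vertices_recoverableD(1)[OF Y]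
  show "(`) f ` {F \<in> X. card F \<le> Suc k} \<subseteq> {F \<in> Y. card F \<le> Suc k}"
  proof
    fix E assume "E \<in> (`) f ` {F \<in> X. card F \<le> Suc k}"
    then obtain F where F: "E = f ` F" "F \<in> X" "card F \<le> Suc k" by blast
    obtain F' where F': "F' \<in> X" "F \<subseteq> F'" "card F' = Suc k"
      using vertices_recoverableD(2)[OF X F(2,3)] by blast
    then have t: "F' \<in> faces_of_size (Suc k) X" by simp
    have "\<phi> F' \<in> Y" using incidence_isoD(1)[OF \<phi> disjI2[OF refl] t] by simp
    then have "E \<in> Y" by (rule simplicial_complexD(4)[OF cpy]) (use f[OF t] F(1) F'(2) in blast)
    moreover have "card E \<le> card F"
      unfolding F(1) by (rule card_image_le[OF simplicial_complexD(3)[OF cpx F(2)]])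
    ultimately show "E \<in> {F \<in> Y. card F \<le> Suc k}" using F(3) by simp
  qed
  show "{F \<in> Y. card F \<le> Suc k} \<subseteq> (`) f ` {F \<in> X. card F \<le> Suc k}"
  proof
    fix E assume "E \<in> {F \<in> Y. card F \<le> Suc k}"
    then have E: "E \<in> Y" "card E \<le> Suc k" by auto
    obtain E' where E': "E' \<in> Y" "E \<subseteq> E'" "card E' = Suc k"
      using vertices_recoverableD(2)[OF Y E] by blast
    then have t: "E' \<in> faces_of_size (Suc k) Y" by simp
    note pre = incidence_isoD(3)[OF \<phi> disjI2[OF refl] t]
    have E'_eq: "E' = f ` \<psi> E'" using f[OF pre] incidence_isoD(4)[OF \<phi> disjI2[OF refl] t] by simp
    define F where "F = {a \<in> \<psi> E'. f a \<in> E}"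
    have P: "\<psi> E' \<in> X" "card (\<psi> E') = Suc k" using pre by auto
    have sub: "F \<subseteq> \<psi> E'" by (auto simp: F_def)
    have "F \<in> X" by (rule simplicial_complexD(4)[OF cpx P(1) sub])
    moreover have "card F \<le> Suc k"
      using card_mono[OF simplicial_complexD(3)[OF cpx P(1)] sub] P(2) by simp
    moreover have "E = f ` F"
    proof
      show "E \<subseteq> f ` F"
      proof
        fix y assume y: "y \<in> E"
        then have "y \<in> f ` \<psi> E'" using E'(2) E'_eq by blast
        then show "y \<in> f ` F" using y by (auto simp: F_def)
      qed
    qed (auto simp: F_def)
    ultimately show "E \<in> (`) f ` {F \<in> X. card F \<le> Suc k}" by blast
  qed
qed

lemma normal_pseudomanifold_recoverable:
  assumes X: "normal_pseudomanifold (d - 1) X" and k: "int k \<le> d - 2"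
  shows "vertices_recoverable k X"
proof -
  have P: "pseudomanifold (d - 1) X"
    and conn: "\<And>j G. 0 \<le> j \<and> j \<le> d - 1 - 2 \<and> G \<in> faces j X \<longrightarrow> connected_complex (link G X)"
    using X unfolding normal_pseudomanifold_def by blast+
  note cpx = pseudomanifoldD(1)[OF P]
  have "\<exists>F'\<in>X. F \<subseteq> F' \<and> card F' = Suc k" if F: "F \<in> X" "card F \<le> Suc k" for F
  proof -
    obtain A where A: "A \<in> X" "int (card A) = d - 1 + 1" "F \<subseteq> A"
      using pseudomanifoldD(3)[OF P F(1)] by blast
    have "Suc k \<le> card A" using A(2) k by simp
    then obtain B where B: "F \<subseteq> B" "B \<subseteq> A" "card B = Suc k"
      using exists_subset_between[OF F(2) _ A(3) simplicial_complexD(3)[OF cpx A(1)]] by blast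
    have "B \<in> X" by (rule simplicial_complexD(4)[OF cpx A(1) B(2)])
    then show ?thesis using B(1,3) by blast
  qed
  moreover have "connected_complex (link G X)" if G: "G \<in> X" "1 \<le> card G" "card G \<le> k" for G
  proof -
    have "G \<in> faces (int (card G) - 1) X" using G(1) by (simp add: faces_def face_dim_def)
    then show ?thesis using conn[of "int (card G) - 1" G] G(2,3) k by simp
  qed
  ultimately show ?thesis using cpx unfolding vertices_recoverable_def by (intro conjI ballI impI) simp_all
qed

text \<open>
  An order isomorphism respects the two levels because each lower face lies strictly below an upper
  one and each upper face lies strictly above a lower one.
\<close>

lemma poset_iso_levels:
  assumes X: "vertices_recoverable k X" and Y: "simplicial_complex Y"
    and \<phi>: "poset_iso (faces_of_size k X \<union> faces_of_size (Suc k) X) (faces_of_size k Y \<union> faces_of_size (Suc k) Y) \<phi>"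
  shows "A \<in> faces_of_size k X \<Longrightarrow> \<phi> A \<in> faces_of_size k Y"
    and "F \<in> faces_of_size (Suc k) X \<Longrightarrow> \<phi> F \<in> faces_of_size (Suc k) Y"
proof -
  note cpx = vertices_recoverableD(1)[OF X]
  have both: "\<phi> A \<in> faces_of_size k Y \<and> \<phi> F \<in> faces_of_size (Suc k) Y"
    if A: "A \<in> faces_of_size k X" and F: "F \<in> faces_of_size (Suc k) X" and AF: "A \<subseteq> F" for A F
  proof -
    let ?P = "faces_of_size k X \<union> faces_of_size (Suc k) X"
    have P: "A \<in> ?P" "F \<in> ?P" using A F by simp_all
    have bij: "bij_betw \<phi> ?P (faces_of_size k Y \<union> faces_of_size (Suc k) Y)"
      using \<phi> unfolding poset_iso_def by (rule conjunct1)
    have Q: "\<phi> A \<in> faces_of_size k Y \<union> faces_of_size (Suc k) Y" "\<phi> F \<in> faces_of_size k Y \<union> faces_of_size (Suc k) Y"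
      using bij_betwE[OF bij] P by blast+
    have "A \<noteq> F" using A F by auto
    then have ne: "\<phi> A \<noteq> \<phi> F" using inj_onD[OF bij_betw_imp_inj_on[OF bij] _ P] by blast
    have "\<forall>x\<in>?P. \<forall>y\<in>?P. x \<subseteq> y \<longleftrightarrow> \<phi> x \<subseteq> \<phi> y" using \<phi> unfolding poset_iso_def by (rule conjunct2)
    from bspec[OF bspec[OF this P(1)] P(2)] have "\<phi> A \<subseteq> \<phi> F" using AF by simp
    then have "\<phi> A \<subset> \<phi> F" using ne by blast
    moreover have "finite (\<phi> F)" using Q(2) simplicial_complexD(3)[OF Y] by blast
    ultimately have "card (\<phi> A) < card (\<phi> F)" by (intro psubset_card_mono)
    then show ?thesis using Q by auto
  qed
  show "\<phi> A \<in> faces_of_size k Y" if A: "A \<in> faces_of_size k X"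
  proof -
    have A': "A \<in> X" "card A \<le> Suc k" using A by auto
    obtain F where F: "F \<in> X" "A \<subseteq> F" "card F = Suc k"
      using vertices_recoverableD(2)[OF X A'] by blast
    then have "F \<in> faces_of_size (Suc k) X" by simp
    from both[OF A this F(2)] show ?thesis by (rule conjunct1)
  qed
  show "\<phi> F \<in> faces_of_size (Suc k) Y" if F: "F \<in> faces_of_size (Suc k) X"
  proof -
    have F': "F \<in> X" "card F = Suc k" using F by auto
    have fin: "finite F" by (rule simplicial_complexD(3)[OF cpx F'(1)])
    have "F \<noteq> {}" using F'(2) by auto
    then obtain v where v: "v \<in> F" by blast
    have "F - {v} \<in> X" by (rule simplicial_complexD(4)[OF cpx F'(1)]) blast
    then have "F - {v} \<in> faces_of_size k X" using v fin F'(2) by simp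
    from both[OF this F Diff_subset] show ?thesis by (rule conjunct2)
  qed
qed

lemma poset_iso_inverse:
  assumes "poset_iso P Q \<phi>"
  shows "poset_iso Q P (inv_into P \<phi>)"
proof -
  have bij: "bij_betw \<phi> P Q" using assms unfolding poset_iso_def by (rule conjunct1)
  have mono: "\<forall>x\<in>P. \<forall>y\<in>P. x \<le> y \<longleftrightarrow> \<phi> x \<le> \<phi> y"
    using assms unfolding poset_iso_def by (rule conjunct2)
  have "x \<le> y \<longleftrightarrow> inv_into P \<phi> x \<le> inv_into P \<phi> y" if x: "x \<in> Q" and y: "y \<in> Q" for x y
  proof -
    have "inv_into P \<phi> x \<in> P" "inv_into P \<phi> y \<in> P"
      using bij_betwE[OF bij_betw_inv_into[OF bij]] x y by blast+
    from bspec[OF bspec[OF mono this(1)] this(2)] show ?thesis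
      using bij_betw_inv_into_right[OF bij x] bij_betw_inv_into_right[OF bij y] by simp
  qed
  then show ?thesis
    unfolding poset_iso_def using bij_betw_inv_into[OF bij] by (intro conjI ballI)
qed

lemma poset_iso_incidence:
  assumes X: "vertices_recoverable k X" and Y: "vertices_recoverable k Y"
    and \<phi>: "poset_iso (faces_of_size k X \<union> faces_of_size (Suc k) X) (faces_of_size k Y \<union> faces_of_size (Suc k) Y) \<phi>"
  shows "incidence_iso k X Y \<phi> (inv_into (faces_of_size k X \<union> faces_of_size (Suc k) X) \<phi>)"
proof -
  let ?P = "faces_of_size k X \<union> faces_of_size (Suc k) X" and ?Q = "faces_of_size k Y \<union> faces_of_size (Suc k) Y"
  let ?\<psi> = "inv_into ?P \<phi>"
  note XY = poset_iso_levels[OF X vertices_recoverableD(1)[OF Y] \<phi>]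
  note YX = poset_iso_levels[OF Y vertices_recoverableD(1)[OF X] poset_iso_inverse[OF \<phi>]]
  have bij: "bij_betw \<phi> ?P ?Q" using \<phi> unfolding poset_iso_def by (rule conjunct1)
  have mono: "\<forall>x\<in>?P. \<forall>y\<in>?P. x \<subseteq> y \<longleftrightarrow> \<phi> x \<subseteq> \<phi> y"
    using \<phi> unfolding poset_iso_def by (rule conjunct2)
  show ?thesis
    unfolding incidence_iso_def
  proof (intro conjI ballI)
    fix i assume "i \<in> {k, Suc k}"
    then consider "i = k" | "i = Suc k" by blast
    note i = this
    show "\<phi> A \<in> faces_of_size i Y" if A: "A \<in> faces_of_size i X" for A
      using i by cases (use XY A in blast)+
    show "?\<psi> B \<in> faces_of_size i X" if B: "B \<in> faces_of_size i Y" for B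
      using i by cases (use YX B in blast)+
    show "?\<psi> (\<phi> A) = A" if A: "A \<in> faces_of_size i X" for A
      by (rule bij_betw_inv_into_left[OF bij]) (use i A in \<open>cases; blast\<close>)
    show "\<phi> (?\<psi> B) = B" if B: "B \<in> faces_of_size i Y" for B
      by (rule bij_betw_inv_into_right[OF bij]) (use i B in \<open>cases; blast\<close>)
  next
    fix A F assume A: "A \<in> faces_of_size k X" and F: "F \<in> faces_of_size (Suc k) X"
    have "A \<in> ?P" "F \<in> ?P" using A F by simp_all
    from bspec[OF bspec[OF mono this(1)] this(2)] show "A \<subseteq> F \<longleftrightarrow> \<phi> A \<subseteq> \<phi> F" .
  qed
qed

section \<open>From the skeleton to the whole complex\<close>

text \<open>
  Removing a vertex \<open>v\<close> from \<open>H\<close> exhibits the link of \<open>H\<close> as the link of \<open>v\<close> in a homology manifold.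
\<close>

lemma homology_manifold_links_sphere:
  assumes X: "simplicial_complex X"
    and M: "\<And>G. G \<in> X \<Longrightarrow> card G = c \<Longrightarrow> homology_manifold (int n) (link G X)"
    and H: "H \<in> X" "card H = Suc c"
  shows "homology_sphere n (link H X)"
proof -
  have "H \<noteq> {}" using H(2) by auto
  then obtain v where v: "v \<in> H" by blast
  define G where "G = H - {v}"
  have HG: "insert v G = H" "v \<notin> G" using v by (auto simp: G_def)
  have G: "G \<in> X" by (rule simplicial_complexD(4)[OF X H(1)]) (use HG in blast)
  have "finite G" by (rule simplicial_complexD(3)[OF X G])
  then have "card G = c" using HG H(2) by auto
  then have L: "homology_manifold (int n) (link G X)" by (rule M[OF G])
  have "{v} \<in> link G X" using HG H(1) by (simp add: mem_link_iff)
  then have "homology_sphere n (link {v} (link G X))"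
    by (rule homology_manifold_link_sphere[OF L]) simp_all
  moreover have "link {v} (link G X) = link H X"
  proof -
    have "link {} (link G X) = link G X" by (simp add: set_eq_iff mem_link_iff)
    then have "link {v} (link G X) = lk v (link G X)" using lk_link[of v "{}" "link G X"] by simp
    also have "\<dots> = link H X" using lk_link[OF HG(2), of X] HG(1) by simp
    finally show ?thesis .
  qed
  ultimately show ?thesis by simp
qed

text \<open>
  A large face \<open>F\<close> contains a face \<open>H\<close> of size \<open>c\<close>, and the link of \<open>H\<close> is a homology sphere of which the
  skeleton shows the faces with at most \<open>m\<close> vertices.
\<close>

lemma complex_determined_by_skeleton:
  assumes X: "simplicial_complex X" and Y: "simplicial_complex Y"
    and skel: "\<And>F. card F \<le> c + m \<Longrightarrow> F \<in> X \<longleftrightarrow> F \<in> Y"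
    and SX: "\<And>H. H \<in> X \<Longrightarrow> card H = c \<Longrightarrow> homology_sphere (2 * m - 1) (link H X)"
    and SY: "\<And>H. H \<in> Y \<Longrightarrow> card H = c \<Longrightarrow> homology_sphere (2 * m - 1) (link H Y)"
  shows "X \<subseteq> Y"
proof
  fix F assume F: "F \<in> X"
  show "F \<in> Y"
  proof (cases "card F \<le> c + m")
    case True
    then show ?thesis using skel F by blast
  next
    case False
    then have "c \<le> card F" by simp
    then obtain H where H: "H \<subseteq> F" "card H = c" "finite H" by (rule obtain_subset_with_card_n)
    have HX: "H \<in> X" by (rule simplicial_complexD(4)[OF X F H(1)])
    have HY: "H \<in> Y" using skel[of H] H(2) HX by simp
    have "link H X \<subseteq> link H Y"
    proof (rule homology_sphere_determined_by_half_skeleton[OF SX[OF HX H(2)] SY[OF HY H(2)]])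
      fix E :: "'a set" assume "card E \<le> m"
      then have "card (E \<union> H) \<le> c + m" using card_Un_le[of E H] H(2) by simp
      then show "E \<in> link H X \<longleftrightarrow> E \<in> link H Y" using skel by (simp add: mem_link_iff)
    qed
    moreover have FH: "F - H \<union> H = F" using H(1) by blast
    have "F - H \<in> link H X" using F FH by (simp only: mem_link_iff) blast
    ultimately have "F - H \<in> link H Y" by blast
    then show ?thesis using FH by (simp only: mem_link_iff)
  qed
qed

lemma image_subset_iff_of_inj:
  assumes f: "inj_on f V" and AB: "A \<subseteq> V" "B \<subseteq> V"
  shows "f ` A \<subseteq> f ` B \<longleftrightarrow> A \<subseteq> B"
proof
  assume *: "f ` A \<subseteq> f ` B"
  show "A \<subseteq> B"
  proof
    fix a assume a: "a \<in> A"
    then have "f a \<in> f ` B" using * by blast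
    moreover have "a \<in> V" using a AB(1) by blast
    ultimately show "a \<in> B" using inj_on_image_mem_iff[OF f _ AB(2)] by blast
  qed
qed (rule image_mono)

lemma link_image:
  assumes f: "inj_on f (\<Union>X)" and H: "H \<in> X"
  shows "link (f ` H) ((`) f ` X) = (`) f ` link H X"
proof
  show "link (f ` H) ((`) f ` X) \<subseteq> (`) f ` link H X"
  proof
    fix E' assume "E' \<in> link (f ` H) ((`) f ` X)"
    then have E': "E' \<inter> f ` H = {}" "E' \<union> f ` H \<in> (`) f ` X" by (simp_all only: mem_link_iff)
    from E'(2) obtain A where A: "E' \<union> f ` H = f ` A" "A \<in> X" by blast
    have sub: "H \<subseteq> \<Union>X" "A \<subseteq> \<Union>X" using H A(2) by blast+
    have "f ` H \<subseteq> f ` A" using A(1) by blast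
    then have HA: "H \<subseteq> A" using image_subset_iff_of_inj[OF f sub] by blast
    have "A - H \<subseteq> \<Union>X" using sub(2) by blast
    then have "f ` (A - H) = f ` A - f ` H" using inj_on_image_set_diff[OF f _ sub(1)] by blast
    moreover have "E' = f ` A - f ` H" using E'(1) A(1) by blast
    moreover have "A - H \<union> H = A" using HA by blast
    then have "A - H \<in> link H X" using A(2) by (simp only: mem_link_iff) blast
    ultimately show "E' \<in> (`) f ` link H X" by blast
  qed
  show "(`) f ` link H X \<subseteq> link (f ` H) ((`) f ` X)"
  proof
    fix E' assume "E' \<in> (`) f ` link H X"
    then obtain E where E: "E' = f ` E" "E \<inter> H = {}" "E \<union> H \<in> X" by (auto simp: mem_link_iff)
    have "E \<subseteq> \<Union>X" "H \<subseteq> \<Union>X" using E(3) by blast+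
    then have "f ` E \<inter> f ` H = f ` (E \<inter> H)" by (rule inj_on_image_Int[OF f, symmetric])
    then have "f ` E \<inter> f ` H = {}" using E(2) by simp
    moreover have "f ` E \<union> f ` H = f ` (E \<union> H)" by (rule image_Un[symmetric])
    ultimately show "E' \<in> link (f ` H) ((`) f ` X)" unfolding mem_link_iff E(1) using E(3) by blast
  qed
qed

lemma vertex_map_complex_iso:
  assumes X: "simplicial_complex X" and Y: "simplicial_complex Y" and f: "inj_on f (\<Union>X)"
    and skel: "(`) f ` {F \<in> X. card F \<le> c + m} = {F \<in> Y. card F \<le> c + m}"
    and SX: "\<And>H. H \<in> X \<Longrightarrow> card H = c \<Longrightarrow> homology_sphere (2 * m - 1) (link H X)"
    and SY: "\<And>H. H \<in> Y \<Longrightarrow> card H = c \<Longrightarrow> homology_sphere (2 * m - 1) (link H Y)"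
  shows "(`) f ` X = Y"
proof -
  let ?X = "(`) f ` X"
  note X' = simplicial_complex_image[OF X, of f]
  have card_f: "card (f ` F) = card F" if "F \<in> X" for F
    by (rule card_image[OF inj_on_subset[OF f]]) (use that in blast)
  have skel': "F \<in> ?X \<longleftrightarrow> F \<in> Y" if F: "card F \<le> c + m" for F
  proof
    assume "F \<in> ?X"
    then obtain E where E: "F = f ` E" "E \<in> X" by blast
    then have "card E \<le> c + m" using card_f F by simp
    then have "f ` E \<in> (`) f ` {F \<in> X. card F \<le> c + m}" using E(2) by blast
    then show "F \<in> Y" unfolding skel E(1) by blast
  next
    assume "F \<in> Y"
    then have "F \<in> {F \<in> Y. card F \<le> c + m}" using F by simp
    then show "F \<in> ?X" unfolding skel[symmetric] by blast
  qed
  have SX': "homology_sphere (2 * m - 1) (link H' ?X)" if H': "H' \<in> ?X" "card H' = c" for H'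
  proof -
    obtain H where H: "H' = f ` H" "H \<in> X" using H'(1) by blast
    have cH: "card H = c" using card_f[OF H(2)] H'(2) H(1) by simp
    have "\<Union> (link H X) \<subseteq> \<Union>X"
    proof
      fix x assume "x \<in> \<Union> (link H X)"
      then obtain E where E: "x \<in> E" "E \<in> link H X" by blast
      have "E \<union> H \<in> X" using E(2) by (simp only: mem_link_iff)
      then show "x \<in> \<Union>X" using E(1) by blast
    qed
    then have "homology_sphere (2 * m - 1) ((`) f ` link H X)"
      by (intro homology_sphere_image[OF SX[OF H(2) cH]] inj_on_subset[OF f])
    then show ?thesis unfolding H(1) link_image[OF f H(2)] .
  qed
  show ?thesis
    using complex_determined_by_skeleton[OF X' Y skel' SX' SY]
      complex_determined_by_skeleton[OF Y X' skel'[symmetric] SY SX'] by (rule equalityI)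
qed

lemma poset_iso_image:
  assumes "inj_on f (\<Union>X)"
  shows "poset_iso X ((`) f ` X) ((`) f)"
proof -
  have "inj_on ((`) f) X" by (rule inj_on_subset[OF inj_on_image_Pow[OF assms]]) blast
  moreover have "F \<subseteq> G \<longleftrightarrow> f ` F \<subseteq> f ` G" if "F \<in> X" "G \<in> X" for F G
    using image_subset_iff_of_inj[OF assms, of F G] that by blast
  ultimately show ?thesis unfolding poset_iso_def by (intro conjI ballI inj_on_imp_bij_betw)
qed

section \<open>The reconstruction theorem\<close>

theorem theorem6p4:
  fixes X :: "'a set set" and Y :: "'b set set" and d k :: int
    and \<phi> :: "'a set \<Rightarrow> 'b set"
  assumes "d \<ge> 5"
    and "\<lceil>(real_of_int d + 1) / 2\<rceil> \<le> k" and "k \<le> d - 2"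
    and "normal_pseudomanifold (d - 1) X"
    and "normal_pseudomanifold (d - 1) Y"
    and "\<And>G. G \<in> faces (2 * k - d - 1) X \<Longrightarrow> homology_manifold (2 * d - 2 * k - 1) (link G X)"
    and "\<And>G. G \<in> faces (2 * k - d - 1) Y \<Longrightarrow> homology_manifold (2 * d - 2 * k - 1) (link G Y)"
    and "poset_iso (faces_between (k - 1) k X) (faces_between (k - 1) k Y) \<phi>"
  shows "\<exists>\<psi>. poset_iso X Y \<psi> \<and> (\<forall>F\<in>faces_between (k - 1) k X. \<psi> F = \<phi> F)"
proof -
  have "(real_of_int d + 1) / 2 \<le> real_of_int k" using assms(2) by (simp only: ceiling_le_iff)
  then have "real_of_int (d + 1) \<le> real_of_int (2 * k)" by simp
  then have dk: "d + 1 \<le> 2 * k" by (simp only: of_int_le_iff)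
  \<comment> \<open>links of faces of size \<open>c\<close> are manifolds of dimension \<open>2m - 1\<close>, so faces of size \<open>c + 1\<close> have sphere links\<close>
  define K c m where "K = nat k" and "c = nat (2 * k - d)" and "m = nat (d - k)"
  have K: "int K = k" "1 \<le> K" and cm: "int c = 2 * k - d" "int m = d - k" "Suc c + m = Suc K"
    "int (2 * m - 1) = 2 * d - 2 * k - 1"
    using dk assms(1,3) by (auto simp: K_def c_def m_def)
  have between: "faces_between (k - 1) k Z = faces_of_size K Z \<union> faces_of_size (Suc K) Z" for Z :: "'c set set"
    using K unfolding faces_between_def faces_def face_dim_def by force
  have X: "vertices_recoverable K X" and Y: "vertices_recoverable K Y"
    using normal_pseudomanifold_recoverable assms(3-5) K by blast+
  note cpx = vertices_recoverableD(1)[OF X] and cpy = vertices_recoverableD(1)[OF Y]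
  have inc: "incidence_iso K X Y \<phi> (inv_into (faces_of_size K X \<union> faces_of_size (Suc K) X) \<phi>)"
    using poset_iso_incidence[OF X Y] assms(8) unfolding between by blast
  from vertex_map_exists[OF X Y K(2) le_refl inc] obtain f where f: "inj_on f (\<Union>X)"
    "\<forall>F. F \<in> faces_of_size K X \<or> F \<in> faces_of_size (Suc K) X \<longrightarrow> \<phi> F = f ` F" by (elim exE conjE)
  have top: "\<phi> F = f ` F" if "F \<in> faces_of_size (Suc K) X" for F
    using f(2) that by blast
  have skel: "(`) f ` {F \<in> X. card F \<le> Suc c + m} = {F \<in> Y. card F \<le> Suc c + m}"
    unfolding cm(3) by (rule vertex_map_skeleton[OF X Y inc top])
  have SX: "homology_sphere (2 * m - 1) (link H X)" if "H \<in> X" "card H = Suc c" for H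
  proof (rule homology_manifold_links_sphere[OF cpx _ that])
    fix G assume "G \<in> X" "card G = c"
    then have "G \<in> faces (2 * k - d - 1) X" using cm(1) by (simp add: faces_def face_dim_def)
    then show "homology_manifold (int (2 * m - 1)) (link G X)" unfolding cm(4) by (rule assms(6))
  qed
  have SY: "homology_sphere (2 * m - 1) (link H Y)" if "H \<in> Y" "card H = Suc c" for H
  proof (rule homology_manifold_links_sphere[OF cpy _ that])
    fix G assume "G \<in> Y" "card G = c"
    then have "G \<in> faces (2 * k - d - 1) Y" using cm(1) by (simp add: faces_def face_dim_def)
    then show "homology_manifold (int (2 * m - 1)) (link G Y)" unfolding cm(4) by (rule assms(7))
  qed
  have "(`) f ` X = Y" by (rule vertex_map_complex_iso[OF cpx cpy f(1) skel SX SY])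
  then have "poset_iso X Y ((`) f)" using poset_iso_image[OF f(1)] by simp
  moreover have "\<forall>F\<in>faces_between (k - 1) k X. f ` F = \<phi> F" unfolding between using f(2) by auto
  ultimately show ?thesis by (intro exI[of _ "(`) f"] conjI)
qed

end
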